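(* Let $\eta\ge4$ be even, $\mu\in\mathbb Z_+$, $\mathcal A=\{\alpha=(\alpha_1,\alpha_2)\in\mathbb Z_+^2:0<|\alpha|\le\mu\}$, and let $\nu:\{1,\dots,\eta^2\}\to Q_\eta^2$ and $\rho:\{1,\dots,|\mathcal A|\}\to\mathcal A$ be bijections. Let $\mathcal H=(\mathsf S^{4\times4})_{\sigma\tau}^{Q_\eta^2}$ and $$C_2=\Big\{\mathbf U\in\mathcal H:\ \sum_{j\in Q_\eta^2}[c_{\alpha j}]\circledast U_j\in\mathsf S\otimes\mathsf S^{3\times3}\text{ for }1\le|\alpha|\le\mu\Big\},\qquad [c_{\alpha j}]=\sum_{k\in Q_\eta^2}[k_2^{\alpha_1}k_1^{\alpha_2}][e^{2\pi k\wedge j/\eta}].$$ Let $R$ be the real $|\mathcal A|\times\eta^2$ matrix with entries $R_{mn}=\nu(n)_2^{\rho(m)_1}\nu(n)_1^{\rho(m)_2}$, and let $S=\begin{bmatrix} S^{(1)} \\ S^{(2)} \\ S^{(3)} \end{bmatrix}$ be the real $3|\mathcal A|\times\eta^2$ matrix with $$S^{(1)}_{mn}=(-1)^{\nu(n)_2}R_{mn},\quad S^{(2)}_{mn}=(-1)^{\nu(n)_1}R_{mn},\quad S^{(3)}_{mn}=(-1)^{\nu(n)_1+\nu(n)_2}R_{mn}.$$ Suppose $RR^*$ and $SS^*$ are invertible, and put $\tilde R=I_{\eta^2}-R^*(RR^* )^{-1}R$, $\tilde S=I_{\eta^2}-S^*(SS^* )^{-1}S$. Let $\mathbf U\in\mathcal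 H$ and $\mathbf A=(A_k)_{k\in Q_\eta^2}=\mathcal F_\eta^{-1}\mathbf U$. Define $\mathbf A^+=(A^+_{\nu(n)})_{n=1}^{\eta^2}$ by $$(A^+_{\nu(n)}[0,0])_{n=1}^{\eta^2}=\big(\tilde S(A_{\nu(n)}[0,0]+A_{\nu(n)}[0,1])_{n=1}^{\eta^2}\big)_s,\quad (A^+_{\nu(n)}[0,1])_{n=1}^{\eta^2}=\big(\tilde S(A_{\nu(n)}[0,0]+A_{\nu(n)}[0,1])_{n=1}^{\eta^2}\big)_v,$$ $$(A^+_{\nu(n)}[0,2j])_{n=1}^{\eta^2}=\big(\tilde R(A_{\nu(n)}[0,2j]+A_{\nu(n)}[0,2j+1])_{n=1}^{\eta^2}\big)_s,\quad (A^+_{\nu(n)}[0,2j+1])_{n=1}^{\eta^2}=\big(\tilde R(A_{\nu(n)}[0,2j]+A_{\nu(n)}[0,2j+1])_{n=1}^{\eta^2}\big)_v$$ for $1\le j\le3$, with row $1$ given by $A^+_{\nu(n)}[1,2j]=A^+_{\nu(n)}[0,2j+1]$ and $A^+_{\nu(n)}[1,2j+1]=A^+_{\nu(n)}[0,2j]$ for $0\le j\le3$, and the remaining rows given by $$A^+_{\nu(n)}[(2,3),(0,1,\dots,7)]=(-1)^{\nu(n)_2}A^+_{\nu(n)}[(0,1),(0,1,\dots,7)],$$ $$A^+_{\nu(n)}[(4,5,6,7),(0,1,\dots,7)]=(-1)^{\nu(n)_1}A^+_{\nu(n)}[(0,1,2,3),(0,1,\dots,7)]$$ for all $n\in\{1,\dots,\eta^2\}$.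 Then $P_{C_2}(\mathbf U)=\mathcal F_\eta\mathbf A^+$.
   Context: Quaternions: $\mathbb R_2=\{x_0+x_1e_1+x_2e_2+x_{12}e_{12}: x_0,x_1,x_2,x_{12}\in\mathbb R\}$ with $e_1^2=e_2^2=e_{12}^2=e_1e_2e_{12}=-1$ (so $e_{12}=e_1e_2=-e_2e_1$). The spinor part of $x$ is $x_s=x_0+x_{12}e_{12}$ and the vector part is $x_v=x_1e_1+x_2e_2$; for a vector in $\mathbb R_2^{\eta^2}$, $(\cdot)_s$ and $(\cdot)_v$ are taken entrywise. For $x,y\in\mathbb R^2$, $x\wedge y=e_{12}(x_1y_2-x_2y_1)$. Here $[e^{2\pi\xi\wedge k}]$ denotes $\mathrm{diag}(e^{2\pi\xi\wedge k},e^{-2\pi\xi\wedge k})$ (similarly $[e^{2\pi k\wedge j/\eta}]=\mathrm{diag}(e^{2\pi k\wedge j/\eta},e^{-2\pi k\wedge j/\eta})$), and for a real constant $c$, $[c]=cI_2$. $\mathbb Z_+$ denotes the nonnegative integers, and $|\alpha|=\alpha_1+\alpha_2$. For $k\in\mathbb Z^2$, write $k=(k_1,k_2)$; so $\nu(n)=(\nu(n)_1,\nu(n)_2)$ and $\rho(m)=(\rho(m)_1,\rho(m)_2)$. $\mathsf S$ is the set of $2\times2$ matrices $\begin{bmatrix} s_1 & v_1 \\ v_2 & s_2 \end{bmatrix}$ with $s_1,s_2\in\mathbb R\oplus\mathbb Re_{12}$ and $v_1,v_2\in\mathbb Re_1\oplus\mathbb Re_2$; $\mathsf S^{m\times m}$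 is the set of $m\times m$ block matrices with blocks in $\mathsf S$ (also viewed as $2m\times2m$ quaternion matrices). $\mathsf S\otimes\mathsf S^{3\times3}$ is the set of block diagonal matrices with first diagonal block in $\mathsf S$ and second in $\mathsf S^{3\times3}$. For $s\in\mathsf S$ and $A\in\mathsf S^{4\times4}$, $s\circledast A$ is obtained by multiplying every $2\times2$ block of $A$ on the left by $s$. $A[i,j]$ is the $(i,j)$ scalar (quaternion) entry of the $8\times8$ matrix $A$, indices $0,\dots,7$; $A[I,J]$ is the submatrix with rows $I$ and columns $J$. $v_1=(1,0),v_2=(0,1),v_3=(1,1)$; $Q_\eta^2=\{0,1,\dots,\eta-1\}^2$, and sample indices are read modulo $\eta$ in each coordinate. With $0,1$ denoting the $2\times2$ blocks $0$ and $I_2$, $$\sigma_1=\begin{bmatrix} 0&1&0&0 \\ 1&0&0&0 \\ 0&0&0&1 \\ 0&0&1&0 \end{bmatrix},\qquad \sigma_2=\begin{bmatrix} 0&0&1&0 \\ 0&0&0&1 \\ 1&0&0&0 \\ 0&1&0&0 \end{bmatrix},$$ and $\tau=\mathrm{diag}(\tau_0,\tau_0,\tau_0,\tau_0)$ with $\tau_0=\begin{bmatrix} 0&1 \\ 1&0 \end{bmatrix}$. The Hilbert module $(\mathsf S^{4\times4})_{\sigma\tau}^{Q_\eta^2}$ is the set of ensembles $\mathbf B=(B_j)_{j\in Q_\eta^2}$, $B_j\in\mathsf S^{4\times4}$, with $B_{j+\eta v_i/2}=\sigma_iB_j$ ($i\in\{1,2\}$) and $B_{\eta v_3-j}=\tau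 B_j\tau$ for all $j\in Q_\eta^2$, equipped with the real inner product $\langle\mathbf U,\mathbf V\rangle_{\mathbb R}$ equal to the sum over all $j$, all matrix entries, and all four real components of the products of corresponding components. For ensembles with entries in $\mathsf S^{4\times4}$: $(\mathcal F_\eta\mathbf B)_j=\sum_{k\in Q_\eta^2}[e^{2\pi j\wedge k/\eta}]\circledast B_k$ and $(\mathcal F_\eta^{-1}\mathbf C)_k=\frac1{\eta^2}\sum_{j\in Q_\eta^2}[e^{2\pi k\wedge j/\eta}]\circledast C_j$. $P_{C}(\mathbf U)$ denotes the set of nearest points (projection) of $\mathbf U$ in $C\subset\mathcal H$ with respect to the norm of $\mathcal H$ (here a single point). *)

theory Defs
  imports
    "HOL-Analysis.Topology_Euclidean_Space"
    "HOL-Library.FuncSet"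
    "Jordan_Normal_Form.Gauss_Jordan_Elimination"
begin

section \<open>Quaternions\<close>

codatatype quat = Quat (Q0: real) (Q1: real) (Q2: real) (Q12: real)

lemma quat_eq_iff: "x = y \<longleftrightarrow> Q0 x = Q0 y \<and> Q1 x = Q1 y \<and> Q2 x = Q2 y \<and> Q12 x = Q12 y"
  by (auto intro: quat.expand)

instantiation quat :: ab_group_add
begin

primcorec zero_quat where
  "Q0 0 = 0" | "Q1 0 = 0" | "Q2 0 = 0" | "Q12 0 = 0"

primcorec plus_quat where
  "Q0 (x + y) = Q0 x + Q0 y"
| "Q1 (x + y) = Q1 x + Q1 y"
| "Q2 (x + y) = Q2 x + Q2 y"
| "Q12 (x + y) = Q12 x + Q12 y"

primcorec uminus_quat where
  "Q0 (- x) = - Q0 x"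
| "Q1 (- x) = - Q1 x"
| "Q2 (- x) = - Q2 x"
| "Q12 (- x) = - Q12 x"

primcorec minus_quat where
  "Q0 (x - y) = Q0 x - Q0 y"
| "Q1 (x - y) = Q1 x - Q1 y"
| "Q2 (x - y) = Q2 x - Q2 y"
| "Q12 (x - y) = Q12 x - Q12 y"

instance
  by standard (simp_all add: quat_eq_iff)

end

instantiation quat :: ring_1
begin

primcorec one_quat where
  "Q0 1 = 1" | "Q1 1 = 0" | "Q2 1 = 0" | "Q12 1 = 0"

primcorec times_quat where
  "Q0 (x * y) = Q0 x * Q0 y - Q1 x * Q1 y - Q2 x * Q2 y - Q12 x * Q12 y"
| "Q1 (x * y) = Q0 x * Q1 y + Q1 x * Q0 y + Q2 x * Q12 y - Q12 x * Q2 y"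
| "Q2 (x * y) = Q0 x * Q2 y - Q1 x * Q12 y + Q2 x * Q0 y + Q12 x * Q1 y"
| "Q12 (x * y) = Q0 x * Q12 y + Q1 x * Q2 y - Q2 x * Q1 y + Q12 x * Q0 y"

instance
  by standard (simp_all add: quat_eq_iff algebra_simps)

end

instantiation quat :: real_algebra_1
begin

primcorec scaleR_quat where
  "Q0 (scaleR r x) = r * Q0 x"
| "Q1 (scaleR r x) = r * Q1 x"
| "Q2 (scaleR r x) = r * Q2 x"
| "Q12 (scaleR r x) = r * Q12 x"

instance
  by standard (simp_all add: quat_eq_iff algebra_simps)

end

instantiation quat :: real_inner
begin

definition inner_quat :: "quat \<Rightarrow> quat \<Rightarrow> real" where
  "inner_quat x y = Q0 x * Q0 y + Q1 x * Q1 y + Q2 x * Q2 y + Q12 x * Q12 y"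

definition norm_quat :: "quat \<Rightarrow> real" where
  "norm_quat x = sqrt (inner x x)"

definition sgn_quat :: "quat \<Rightarrow> quat" where
  "sgn_quat x = x /\<^sub>R norm x"

definition dist_quat :: "quat \<Rightarrow> quat \<Rightarrow> real" where
  "dist_quat x y = norm (x - y)"

definition uniformity_quat :: "(quat \<times> quat) filter" where
  "uniformity_quat = (INF e\<in>{0 <..}. principal {(x, y). dist x y < e})"

definition open_quat :: "quat set \<Rightarrow> bool" where
  "open_quat U \<longleftrightarrow> (\<forall>x\<in>U. eventually (\<lambda>(x', y). x' = x \<longrightarrow> y \<in> U) uniformity)"

instance
proof
  fix x y z :: quat and r :: real and U :: "quat set"
  show "inner x y = inner y x"
    by (simp add: inner_quat_def mult.commute)
  show "inner (x + y) z = inner x z + inner y z"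
    by (simp add: inner_quat_def algebra_simps)
  show "inner (scaleR r x) y = r * inner x y"
    by (simp add: inner_quat_def algebra_simps)
  show "0 \<le> inner x x"
    by (simp add: inner_quat_def)
  show "inner x x = 0 \<longleftrightarrow> x = 0"
    by (simp add: inner_quat_def quat_eq_iff add_nonneg_eq_0_iff)
qed (rule norm_quat_def sgn_quat_def dist_quat_def uniformity_quat_def open_quat_def)+

end

definition e1 :: quat where "e1 = Quat 0 1 0 0"
definition e2 :: quat where "e2 = Quat 0 0 1 0"
definition e12 :: quat where "e12 = Quat 0 0 0 1"

lemma quat_unit_mult:
  "e1 * e1 = -1" "e2 * e2 = -1" "e12 * e12 = -1" "e1 * e2 * e12 = -1"
  "e1 * e2 = e12" "e2 * e1 = - e12"
  by (simp_all add: quat_eq_iff e1_def e2_def e12_def)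

lemma quat_expand:
  "x = of_real (Q0 x) + of_real (Q1 x) * e1 + of_real (Q2 x) * e2 + of_real (Q12 x) * e12"
  by (simp add: quat_eq_iff e1_def e2_def e12_def of_real_def)

instance quat :: real_normed_algebra_1
proof
  fix x y :: quat
  have "inner (x * y) (x * y) = inner x x * inner y y"
    unfolding inner_quat_def times_quat.sel by (simp only: algebra_simps)
  then show "norm (x * y) \<le> norm x * norm y"
    by (simp only: norm_quat_def real_sqrt_mult order_refl)
  show "norm (1 :: quat) = 1"
    by (simp add: norm_quat_def inner_quat_def)
qed

text \<open>Being a Euclidean space makes \<^typ>\<open>quat\<close> a Banach algebra, so that the library's
  \<^const>\<open>exp\<close> applies to it.\<close>

instantiation quat :: euclidean_space
begin

definition Basis_quat :: "quat set" where
  "Basis_quat = {1, e1, e2, e12}"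

instance
proof
  show "finite (Basis :: quat set)" "(Basis :: quat set) \<noteq> {}"
    by (simp_all add: Basis_quat_def)
next
  fix u v :: quat
  assume "u \<in> Basis" "v \<in> Basis"
  then show "inner u v = (if u = v then 1 else 0)"
    unfolding Basis_quat_def insert_iff empty_iff
    by (elim disjE FalseE) (simp_all add: inner_quat_def e1_def e2_def e12_def quat_eq_iff)
next
  fix x :: quat
  show "(\<forall>u\<in>Basis. inner x u = 0) = (x = 0)"
    unfolding Basis_quat_def ball_simps
    by (simp add: inner_quat_def e1_def e2_def e12_def quat_eq_iff)
qed

end

definition spinor_part :: "quat \<Rightarrow> quat" where
  "spinor_part x = of_real (Q0 x) + of_real (Q12 x) * e12"

definition vector_part :: "quat \<Rightarrow> quat" where
  "vector_part x = of_real (Q1 x) * e1 + of_real (Q2 x) * e2"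

definition spinors :: "quat set" where
  "spinors = {of_real a + of_real b * e12 | a b. True}"

definition vectors :: "quat set" where
  "vectors = {of_real a * e1 + of_real b * e2 | a b. True}"

definition wedge :: "real \<times> real \<Rightarrow> real \<times> real \<Rightarrow> quat" where
  "wedge x y = of_real (fst x * snd y - snd x * fst y) * e12"


section \<open>Block matrices\<close>

definition mat_sum :: "nat \<Rightarrow> nat \<Rightarrow> ('i \<Rightarrow> 'a::comm_monoid_add mat) \<Rightarrow> 'i set \<Rightarrow> 'a mat" where
  "mat_sum nr nc f I = mat nr nc (\<lambda>(r, c). \<Sum>i\<in>I. f i $$ (r, c))"

definition S_alg :: "quat mat set" where
  "S_alg = {M \<in> carrier_mat 2 2.
     M $$ (0, 0) \<in> spinors \<and> M $$ (0, 1) \<in> vectors \<and>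
     M $$ (1, 0) \<in> vectors \<and> M $$ (1, 1) \<in> spinors}"

definition blk :: "'a mat \<Rightarrow> nat \<Rightarrow> nat \<Rightarrow> 'a mat" where
  "blk A p q = mat 2 2 (\<lambda>(r, c). A $$ (2 * p + r, 2 * q + c))"

definition S_mat :: "nat \<Rightarrow> quat mat set" where
  "S_mat m = {A \<in> carrier_mat (2 * m) (2 * m). \<forall>p<m. \<forall>q<m. blk A p q \<in> S_alg}"

definition S_diag13 :: "quat mat set" where
  "S_diag13 = {diag_block_mat [M, D] | M D. M \<in> S_alg \<and> D \<in> S_mat 3}"

definition block_act :: "quat mat \<Rightarrow> quat mat \<Rightarrow> quat mat" (infixr "\<circledast>" 70) where
  "s \<circledast> A = mat (dim_row A) (dim_col A)
     (\<lambda>(r, c). (s * blk A (r div 2) (c div 2)) $$ (r mod 2, c mod 2))"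

definition real_bracket :: "real \<Rightarrow> quat mat" where
  "real_bracket c = of_real c \<cdot>\<^sub>m 1\<^sub>m 2"

definition exp_bracket :: "quat \<Rightarrow> quat mat" where
  "exp_bracket x = mat_of_rows_list 2 [[exp x, 0], [0, exp (- x)]]"

text \<open>Replace every scalar entry \<open>a\<close> of a matrix by the \<open>2 \<times> 2\<close> block \<open>a I\<^sub>2\<close>.\<close>

definition inflate :: "'a::semiring_1 mat \<Rightarrow> 'a mat" where
  "inflate P = mat (2 * dim_row P) (2 * dim_col P)
     (\<lambda>(r, c). P $$ (r div 2, c div 2) * 1\<^sub>m 2 $$ (r mod 2, c mod 2))"

definition sigma1 :: "quat mat" where
  "sigma1 = inflate (mat_of_rows_list 4
     [[0, 1, 0, 0],
      [1, 0, 0, 0],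
      [0, 0, 0, 1],
      [0, 0, 1, 0]])"

definition sigma2 :: "quat mat" where
  "sigma2 = inflate (mat_of_rows_list 4
     [[0, 0, 1, 0],
      [0, 0, 0, 1],
      [1, 0, 0, 0],
      [0, 1, 0, 0]])"

definition tau0 :: "quat mat" where
  "tau0 = mat_of_rows_list 2 [[0, 1], [1, 0]]"

definition tau :: "quat mat" where
  "tau = diag_block_mat [tau0, tau0, tau0, tau0]"


section \<open>Ensembles\<close>

definition Qgrid :: "nat \<Rightarrow> (nat \<times> nat) set" where
  "Qgrid \<eta> = {0..<\<eta>} \<times> {0..<\<eta>}"

definition red :: "nat \<Rightarrow> nat \<times> nat \<Rightarrow> nat \<times> nat" where
  "red \<eta> j = (fst j mod \<eta>, snd j mod \<eta>)"

definition wedge_nat :: "nat \<times> nat \<Rightarrow> nat \<times> nat \<Rightarrow> quat" where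
  "wedge_nat j k = wedge (real (fst j), real (snd j)) (real (fst k), real (snd k))"

type_synonym ensemble = "nat \<times> nat \<Rightarrow> quat mat"

text \<open>An ensemble indexed by the grid is a function in the extensional function space over it,
  i.e. one that is \<^const>\<open>undefined\<close> off the grid. The subtractions \<open>\<eta> - j\<^sub>1\<close>, \<open>\<eta> - j\<^sub>2\<close>
  below are not truncated, since \<open>j\<close> lies in the grid.\<close>

definition H_module :: "nat \<Rightarrow> ensemble set" where
  "H_module \<eta> = {B \<in> Qgrid \<eta> \<rightarrow>\<^sub>E S_mat 4. \<forall>j\<in>Qgrid \<eta>.
     B (red \<eta> (fst j + \<eta> div 2, snd j)) = sigma1 * B j \<and>
     B (red \<eta> (fst j, snd j + \<eta> div 2)) = sigma2 * B j \<and>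
     B (red \<eta> (\<eta> - fst j, \<eta> - snd j)) = tau * B j * tau}"

definition ens_inner :: "nat \<Rightarrow> ensemble \<Rightarrow> ensemble \<Rightarrow> real" where
  "ens_inner \<eta> U V = (\<Sum>j\<in>Qgrid \<eta>. \<Sum>r<8. \<Sum>c<8. inner (U j $$ (r, c)) (V j $$ (r, c)))"

definition ens_norm :: "nat \<Rightarrow> ensemble \<Rightarrow> real" where
  "ens_norm \<eta> U = sqrt (ens_inner \<eta> U U)"

definition ens_diff :: "nat \<Rightarrow> ensemble \<Rightarrow> ensemble \<Rightarrow> ensemble" where
  "ens_diff \<eta> U V = (\<lambda>j\<in>Qgrid \<eta>. U j - V j)"

definition proj_set :: "nat \<Rightarrow> ensemble set \<Rightarrow> ensemble \<Rightarrow> ensemble set" where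
  "proj_set \<eta> C U =
     {V \<in> C. \<forall>W\<in>C. ens_norm \<eta> (ens_diff \<eta> U V) \<le> ens_norm \<eta> (ens_diff \<eta> U W)}"

definition Fourier :: "nat \<Rightarrow> ensemble \<Rightarrow> ensemble" where
  "Fourier \<eta> B = (\<lambda>j\<in>Qgrid \<eta>. mat_sum 8 8
     (\<lambda>k. exp_bracket (of_real (2 * pi / real \<eta>) * wedge_nat j k) \<circledast> B k) (Qgrid \<eta>))"

definition Fourier_inv :: "nat \<Rightarrow> ensemble \<Rightarrow> ensemble" where
  "Fourier_inv \<eta> C = (\<lambda>k\<in>Qgrid \<eta>. of_real (1 / (real \<eta>)\<^sup>2) \<cdot>\<^sub>m mat_sum 8 8
     (\<lambda>j. exp_bracket (of_real (2 * pi / real \<eta>) * wedge_nat k j) \<circledast> C j) (Qgrid \<eta>))"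

definition multi_idx :: "nat \<Rightarrow> (nat \<times> nat) set" where
  "multi_idx \<mu> = {\<alpha>. 0 < fst \<alpha> + snd \<alpha> \<and> fst \<alpha> + snd \<alpha> \<le> \<mu>}"

definition c_coeff :: "nat \<Rightarrow> nat \<times> nat \<Rightarrow> nat \<times> nat \<Rightarrow> quat mat" where
  "c_coeff \<eta> \<alpha> j = mat_sum 2 2
     (\<lambda>k. real_bracket (real (snd k) ^ fst \<alpha> * real (fst k) ^ snd \<alpha>) *
          exp_bracket (of_real (2 * pi / real \<eta>) * wedge_nat k j)) (Qgrid \<eta>)"

definition C2 :: "nat \<Rightarrow> nat \<Rightarrow> ensemble set" where
  "C2 \<eta> \<mu> = {U \<in> H_module \<eta>. \<forall>\<alpha>\<in>multi_idx \<mu>.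
     mat_sum 8 8 (\<lambda>j. c_coeff \<eta> \<alpha> j \<circledast> U j) (Qgrid \<eta>) \<in> S_diag13}"

text \<open>Action of a real matrix on a quaternionic column vector.\<close>

definition real_mat_act :: "real mat \<Rightarrow> quat vec \<Rightarrow> quat vec" where
  "real_mat_act M x = map_mat of_real M *\<^sub>v x"

end

theory Submission
  imports Defs
begin

text \<open>
  The Fourier transform makes all the data of the problem diagonal. Translation of the samples by
  half a period becomes multiplication of the coefficient at \<open>k\<close> by a sign \<open>(-1)\<^bsup>k\<^sub>2\<^esup>\<close> or
  \<open>(-1)\<^bsup>k\<^sub>1\<^esup>\<close>, so the relations with \<open>\<sigma>\<^sub>1\<close> and \<open>\<sigma>\<^sub>2\<close> say that the four block rows of each coefficient
  agree up to sign; reflection of the samples conjugates the phases, so the relation with \<open>\<tau>\<close> says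
  that row 1 repeats row 0 with its columns exchanged in pairs. What remains free is the first row,
  that is, for each frequency four spinors and four vectors, or four arbitrary quaternions
  \<open>a k 0, \<dots>, a k 3\<close>. The module is thus parametrised by families \<open>a\<close> (lemmas
  \<open>Fourier_spectrum_in_H_module\<close> and \<open>Fourier_inv_H_module\<close>), and by Parseval's identity its norm is a
  constant multiple of the Euclidean norm of \<open>a\<close> (\<open>ens_inner_Fourier_spectrum\<close>).

  In these coordinates the defining conditions of \<open>C\<^sub>2\<close> are conditions on moments of the coefficients
  (\<open>Fourier_spectrum_in_C2_iff\<close>). They decouple over the four columns: \<open>(a k q)\<^sub>k\<close> must lie in the null
  space of \<open>R\<close> for \<open>q = 1, 2, 3\<close>, whereas for \<open>q = 0\<close> it is the three blocks below the first one that must vanish,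
  whose entries carry the signs of the block rows, and this is the null space of \<open>S\<close>
  (\<open>vanishing_moments_null_space\<close>). Since \<open>I - M\<^sup>T (M M\<^sup>T)\<^sup>-\<^sup>1 M\<close> is the orthogonal projection onto the
  null space of a real matrix \<open>M\<close>, acting on the four components of a quaternion separately
  (\<open>real_mat_act_projection\<close>), applying it in every column gives the coefficients of the nearest point,
  which is unique by Pythagoras (\<open>proj_set_C2I\<close>).
\<close>

section \<open>Spinors, vectors and roots of unity\<close>

text \<open>The quaternions are graded by \<open>\<int>/2\<close>: spinors are even, vectors odd. The blocks of a
  matrix over the algebra S carry spinors where the row and column indices have equal parity and vectors
  elsewhere, so that one degree \<open>r + c\<close> describes every entry.\<close>

definition graded_part :: "nat \<Rightarrow> quat \<Rightarrow> quat" where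
  "graded_part d x = (if even d then spinor_part x else vector_part x)"

lemma quat_sel_of_real [simp]:
  "Q0 (of_real c) = c" "Q1 (of_real c) = 0" "Q2 (of_real c) = 0" "Q12 (of_real c) = 0"
  by (simp_all add: of_real_def)

lemma quat_sel_spinor_part [simp]:
  "Q0 (spinor_part x) = Q0 x" "Q1 (spinor_part x) = 0"
  "Q2 (spinor_part x) = 0" "Q12 (spinor_part x) = Q12 x"
  by (simp_all add: spinor_part_def e12_def)

lemma quat_sel_vector_part [simp]:
  "Q0 (vector_part x) = 0" "Q1 (vector_part x) = Q1 x"
  "Q2 (vector_part x) = Q2 x" "Q12 (vector_part x) = 0"
  by (simp_all add: vector_part_def e1_def e2_def)

lemma quat_sel_graded_part [simp]:
  "Q0 (graded_part d x) = (if even d then Q0 x else 0)"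
  "Q1 (graded_part d x) = (if even d then 0 else Q1 x)"
  "Q2 (graded_part d x) = (if even d then 0 else Q2 x)"
  "Q12 (graded_part d x) = (if even d then Q12 x else 0)"
  by (simp_all add: graded_part_def)

lemma quat_sel_sum [simp]:
  "Q0 (sum f I) = (\<Sum>i\<in>I. Q0 (f i))" "Q1 (sum f I) = (\<Sum>i\<in>I. Q1 (f i))"
  "Q2 (sum f I) = (\<Sum>i\<in>I. Q2 (f i))" "Q12 (sum f I) = (\<Sum>i\<in>I. Q12 (f i))"
  by ((induction I rule: infinite_finite_induct; simp)+)

lemma graded_part_simps:
  "graded_part d (x + y) = graded_part d x + graded_part d y"
  "graded_part d (x - y) = graded_part d x - graded_part d y"
  "graded_part d (c *\<^sub>R x) = c *\<^sub>R graded_part d x"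
  "graded_part d 0 = 0"
  by (simp_all add: quat_eq_iff)

lemma graded_part_sum: "graded_part d (sum f I) = (\<Sum>i\<in>I. graded_part d (f i))"
  by (simp add: quat_eq_iff)

lemma graded_part_add_Suc: "graded_part d x + graded_part (Suc d) x = x"
  by (simp add: quat_eq_iff)

lemma graded_part_idem:
  "graded_part d (graded_part d' x) = (if even d = even d' then graded_part d x else 0)"
  by (simp add: quat_eq_iff)

lemma inner_graded_parts:
  "inner (graded_part d x) (graded_part d y) + inner (graded_part (Suc d) x) (graded_part (Suc d) y)
   = inner x y"
  by (simp add: inner_quat_def)

lemma spinors_iff: "x \<in> spinors \<longleftrightarrow> graded_part 0 x = x"
proof
  assume "graded_part 0 x = x"
  then have "x = of_real (Q0 x) + of_real (Q12 x) * e12"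
    by (simp add: graded_part_def spinor_part_def)
  then show "x \<in> spinors"
    unfolding spinors_def by blast
qed (auto simp: spinors_def quat_eq_iff e12_def)

lemma vectors_iff: "x \<in> vectors \<longleftrightarrow> graded_part 1 x = x"
proof
  assume "graded_part 1 x = x"
  then have "x = of_real (Q1 x) * e1 + of_real (Q2 x) * e2"
    by (simp add: graded_part_def vector_part_def)
  then show "x \<in> vectors"
    unfolding vectors_def by blast
qed (auto simp: vectors_def quat_eq_iff e1_def e2_def)

lemma graded_part_parity: "even d = even d' \<Longrightarrow> graded_part d = graded_part d'"
  by (simp add: graded_part_def fun_eq_iff)

lemma S_mat_iff:
  "A \<in> S_mat m \<longleftrightarrow> A \<in> carrier_mat (2 * m) (2 * m) \<and>
     (\<forall>r<2*m. \<forall>c<2*m. graded_part (r + c) (A $$ (r, c)) = A $$ (r, c))"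
  (is "_ \<longleftrightarrow> _ \<and> ?graded")
proof -
  have blk: "blk A p q \<in> S_alg \<longleftrightarrow>
      (\<forall>r<2. \<forall>c<2. graded_part (r + c) (A $$ (2 * p + r, 2 * q + c)) = A $$ (2 * p + r, 2 * q + c))"
    for p q
    by (auto simp: S_alg_def blk_def spinors_iff vectors_iff numeral_2_eq_2 less_Suc_eq
        graded_part_parity[of 2 0] graded_part_parity[of "Suc (Suc 0)" 0])
  have "(\<forall>p<m. \<forall>q<m. blk A p q \<in> S_alg) \<longleftrightarrow> ?graded"
  proof (intro iffI allI impI)
    fix r c assume H: "\<forall>p<m. \<forall>q<m. blk A p q \<in> S_alg" and rc: "r < 2 * m" "c < 2 * m"
    then have "blk A (r div 2) (c div 2) \<in> S_alg"
      by auto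
    then have "graded_part (r mod 2 + c mod 2) (A $$ (2 * (r div 2) + r mod 2, 2 * (c div 2) + c mod 2))
        = A $$ (2 * (r div 2) + r mod 2, 2 * (c div 2) + c mod 2)"
      unfolding blk by (meson mod_less_divisor pos2)
    moreover have "graded_part (r mod 2 + c mod 2) = graded_part (r + c)"
      by (rule graded_part_parity) (simp add: mod_add_eq even_iff_mod_2_eq_zero mod_add_left_eq mod_add_right_eq)
    ultimately show "graded_part (r + c) (A $$ (r, c)) = A $$ (r, c)"
      by simp
  next
    fix p q assume H: ?graded and pq: "p < m" "q < m"
    show "blk A p q \<in> S_alg"
      unfolding blk
    proof (intro allI impI)
      fix r c :: nat assume "r < 2" "c < 2"
      then have "graded_part (2 * p + r + (2 * q + c)) (A $$ (2 * p + r, 2 * q + c)) = A $$ (2 * p + r, 2 * q + c)"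
        using H pq by auto
      moreover have "graded_part (2 * p + r + (2 * q + c)) = graded_part (r + c)"
        by (rule graded_part_parity) simp
      ultimately show "graded_part (r + c) (A $$ (2 * p + r, 2 * q + c)) = A $$ (2 * p + r, 2 * q + c)"
        by simp
    qed
  qed
  then show ?thesis
    by (simp add: S_mat_def)
qed

text \<open>The even quaternions \<open>x + y e\<^sub>1\<^sub>2\<close> are a copy of the complex numbers, so the exponentials
  and character sums below are those of \<open>\<complex>\<close>.\<close>

definition quat_of_complex :: "complex \<Rightarrow> quat" where
  "quat_of_complex z = Quat (Re z) 0 0 (Im z)"

lemma quat_sel_of_complex [simp]:
  "Q0 (quat_of_complex z) = Re z" "Q1 (quat_of_complex z) = 0"
  "Q2 (quat_of_complex z) = 0" "Q12 (quat_of_complex z) = Im z"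
  by (simp_all add: quat_of_complex_def)

lemma quat_of_complex_hom:
  "quat_of_complex (w * z) = quat_of_complex w * quat_of_complex z"
  "quat_of_complex 1 = 1"
  by (simp_all add: quat_eq_iff)

lemma quat_of_complex_power: "quat_of_complex (z ^ n) = quat_of_complex z ^ n"
  by (induction n) (simp_all add: quat_of_complex_hom)

lemma bounded_linear_quat_of_complex: "bounded_linear quat_of_complex"
  by (subst linear_conv_bounded_linear[symmetric], rule linearI) (simp_all add: quat_eq_iff)

lemma exp_quat_of_complex: "exp (quat_of_complex z) = quat_of_complex (exp z)"
proof -
  have "(\<lambda>n. quat_of_complex (z ^ n /\<^sub>R fact n)) sums quat_of_complex (exp z)"
    by (rule bounded_linear.sums[OF bounded_linear_quat_of_complex exp_converges])
  then have "(\<lambda>n. quat_of_complex z ^ n /\<^sub>R fact n) sums quat_of_complex (exp z)"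
    by (simp add: bounded_linear.linear[OF bounded_linear_quat_of_complex, THEN linear_scale]
        quat_of_complex_power)
  then show ?thesis
    using exp_converges sums_unique2 by blast
qed

text \<open>The root of unity \<open>exp (2 \<pi> n e\<^sub>1\<^sub>2 / \<eta>)\<close>. The integer argument turns the reduction of
  sample indices modulo \<open>\<eta>\<close> into plain periodicity.\<close>

definition phase :: "nat \<Rightarrow> int \<Rightarrow> quat" where
  "phase \<eta> n = quat_of_complex (cis (2 * pi * of_int n / real \<eta>))"

lemma phase_add: "phase \<eta> (m + n) = phase \<eta> m * phase \<eta> n"
  by (simp add: phase_def quat_of_complex_hom[symmetric] cis_mult algebra_simps add_divide_distrib)

lemma phase_period: 
  assumes "\<eta> > 0" shows "phase \<eta> (int \<eta> * n) = 1"
proof -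
  have "2 * pi * of_int (int \<eta> * n) / real \<eta> = 2 * pi * of_int n"
    using assms by simp
  then show ?thesis
    by (simp only: phase_def) (simp add: cis_multiple_2pi quat_of_complex_hom)
qed

text \<open>Half-period shifts of the samples become the signs \<open>(-1)\<^sup>n\<close> through
  \<open>exp (\<pi> e\<^sub>1\<^sub>2) = -1\<close>.\<close>

lemma phase_half:
  assumes "\<eta> > 0" "even \<eta>" shows "phase \<eta> (int (\<eta> div 2) * n) = (if even n then 1 else - 1)"
proof (cases "even n")
  case True
  then obtain k where "n = 2 * k" by blast
  then have "int (\<eta> div 2) * n = int \<eta> * k"
    using assms(2) by (auto simp: zdiv_int)
  then show ?thesis using True by (simp only: phase_period[OF assms(1)] if_True)
next
  case False
  then obtain k where "n = 2 * k + 1" by (auto elim: oddE)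
  then have n: "int (\<eta> div 2) * n = int \<eta> * k + int (\<eta> div 2)"
    using assms(2) by (auto simp: zdiv_int algebra_simps)
  have "2 * pi * real_of_int (int (\<eta> div 2)) / real \<eta> = pi"
    using assms by (auto elim!: evenE)
  then have "phase \<eta> (int (\<eta> div 2)) = - 1"
    unfolding phase_def by (simp add: quat_eq_iff)
  then show ?thesis using False by (simp add: n phase_add phase_period[OF assms(1)])
qed

lemma inner_phase_mult: "inner (phase \<eta> n * x) y = inner x (phase \<eta> (- n) * y)"
  by (simp add: phase_def inner_quat_def algebra_simps)

lemma graded_part_phase_mult: "graded_part d (phase \<eta> n * x) = phase \<eta> n * graded_part d x"
  by (simp add: phase_def quat_eq_iff)

lemma sum_phase:
  assumes "\<eta> > 0"
  shows "(\<Sum>j<\<eta>. phase \<eta> (int j * n)) = (if int \<eta> dvd n then of_nat \<eta> else 0)"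
proof (cases "int \<eta> dvd n")
  case True
  then have "phase \<eta> (int j * n) = 1" for j
    using phase_period[OF assms] by (metis dvd_def mult.left_commute)
  then show ?thesis using True by simp
next
  case False
  let ?z = "cis (2 * pi * of_int n / real \<eta>)"
  have pow: "?z ^ j = cis (2 * pi * of_int (int j * n) / real \<eta>)" for j
    by (simp add: DeMoivre algebra_simps)
  have "?z \<noteq> 1"
  proof
    assume "?z = 1"
    then have "cos (2 * pi * of_int n / real \<eta>) = 1"
      by (simp add: complex_eq_iff)
    then obtain k :: int where "2 * pi * of_int n / real \<eta> = of_int k * (2 * pi)"
      by (auto simp: cos_one_2pi_int mult.assoc)
    then have "real_of_int n = real_of_int (int \<eta> * k)"
      using assms by (simp add: field_simps)
    then have "n = int \<eta> * k" by linarith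
    then show False using False by simp
  qed
  moreover have "?z ^ \<eta> = 1"
  proof -
    have "2 * pi * of_int (int \<eta> * n) / real \<eta> = 2 * pi * of_int n"
      using assms by simp
    then show ?thesis
      by (simp only: pow) (simp add: cis_multiple_2pi)
  qed
  ultimately have "(\<Sum>j<\<eta>. ?z ^ j) = 0"
    by (simp add: geometric_sum)
  then have "quat_of_complex (\<Sum>j<\<eta>. ?z ^ j) = 0"
    by (simp add: quat_eq_iff)
  then have "(\<Sum>j<\<eta>. quat_of_complex (?z ^ j)) = 0"
    by (simp add: bounded_linear.linear[OF bounded_linear_quat_of_complex, THEN linear_sum])
  then show ?thesis using False by (simp add: phase_def pow)
qed

section \<open>The Fourier transform on the grid\<close>

definition iwedge :: "nat \<times> nat \<Rightarrow> nat \<times> nat \<Rightarrow> int" where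
  "iwedge j k = int (fst j) * int (snd k) - int (snd j) * int (fst k)"

text \<open>Left multiplication by \<open>diag (exp z, exp (- z))\<close> treats the matrix entries separately, with
  \<open>s = 1\<close> on even rows and \<open>s = -1\<close> on odd ones; hence a scalar transform suffices. The index of the
  output stands first in the wedge, and the wedge is antisymmetric: this is why the same formula
  describes both the transform and, up to the factor \<open>\<eta>\<^sup>2\<close>, its inverse.\<close>

definition dft :: "nat \<Rightarrow> int \<Rightarrow> (nat \<times> nat \<Rightarrow> quat) \<Rightarrow> nat \<times> nat \<Rightarrow> quat" where
  "dft \<eta> s x j = (\<Sum>k\<in>Qgrid \<eta>. phase \<eta> (s * iwedge j k) * x k)"

lemma iwedge_commute: "iwedge k j = - iwedge j k"
  by (simp add: iwedge_def)

lemma finite_Qgrid [simp]: "finite (Qgrid \<eta>)"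
  by (simp add: Qgrid_def)

lemma dft_cong: "(\<And>k. k \<in> Qgrid \<eta> \<Longrightarrow> x k = y k) \<Longrightarrow> dft \<eta> s x j = dft \<eta> s y j"
  by (simp add: dft_def)

lemma dft_scaleR: "dft \<eta> s (\<lambda>k. c *\<^sub>R x k) j = c *\<^sub>R dft \<eta> s x j"
  by (simp add: dft_def scaleR_sum_right)

lemma dft_diff: "dft \<eta> s (\<lambda>k. x k - y k) j = dft \<eta> s x j - dft \<eta> s y j"
  by (simp add: dft_def right_diff_distrib sum_subtractf)

lemma graded_part_dft: "graded_part d (dft \<eta> s x j) = dft \<eta> s (\<lambda>k. graded_part d (x k)) j"
  by (simp add: dft_def graded_part_sum graded_part_phase_mult)

text \<open>The two wedges add up to \<open>(j - l) \<and> k\<close>, so the sum factors into two character sums over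
  \<open>\<int>/\<eta>\<close>, one for each coordinate of \<open>k\<close>.\<close>

lemma phase_orthogonality:
  assumes "\<eta> > 0" "j \<in> Qgrid \<eta>" "l \<in> Qgrid \<eta>" "\<bar>s\<bar> = 1"
  shows "(\<Sum>k\<in>Qgrid \<eta>. phase \<eta> (s * iwedge j k) * phase \<eta> (s * iwedge k l)) =
         (if j = l then of_nat (\<eta>\<^sup>2) else 0)"
proof -
  \<comment> \<open>The differences of the two coordinates, which pair with the opposite coordinates of \<open>k\<close>.\<close>
  define a b where "a = s * (int (fst j) - int (fst l))" and "b = s * (int (snd l) - int (snd j))"
  have dvd: "int \<eta> dvd s * (int m - int n) \<longleftrightarrow> m = n" if "m < \<eta>" "n < \<eta>" for m n
  proof -
    have "int \<eta> dvd s * (int m - int n) \<longleftrightarrow> int \<eta> dvd int m - int n"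
      using assms(4) by (simp add: abs_eq_iff') (auto simp: dvd_diff_commute)
    also have "\<dots> \<longleftrightarrow> int m mod int \<eta> = int n mod int \<eta>"
      by (simp add: mod_eq_dvd_iff)
    also have "\<dots> \<longleftrightarrow> m = n"
      using that by simp
    finally show ?thesis .
  qed
  have "(\<Sum>k\<in>Qgrid \<eta>. phase \<eta> (s * iwedge j k) * phase \<eta> (s * iwedge k l)) =
        (\<Sum>(p, q)\<in>{..<\<eta>} \<times> {..<\<eta>}. phase \<eta> (int p * b) * phase \<eta> (int q * a))"
    unfolding Qgrid_def lessThan_atLeast0 phase_add[symmetric]
    by (intro sum.cong refl arg_cong[of _ _ "phase \<eta>"])
       (auto simp: iwedge_def a_def b_def algebra_simps)
  also have "\<dots> = (\<Sum>p<\<eta>. phase \<eta> (int p * b)) * (\<Sum>q<\<eta>. phase \<eta> (int q * a))"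
    by (simp add: sum_product sum.cartesian_product)
  also have "\<dots> = (if j = l then of_nat (\<eta>\<^sup>2) else 0)"
    using assms(2,3) dvd[of "fst j" "fst l"] dvd[of "snd l" "snd j"]
    by (auto simp: sum_phase[OF assms(1)] a_def b_def Qgrid_def power2_eq_square)
  finally show ?thesis .
qed

lemma dft_dft:
  assumes "\<eta> > 0" "j \<in> Qgrid \<eta>" "\<bar>s\<bar> = 1"
  shows "dft \<eta> s (dft \<eta> s x) j = (real \<eta>)\<^sup>2 *\<^sub>R x j"
proof -
  have "dft \<eta> s (dft \<eta> s x) j =
      (\<Sum>k\<in>Qgrid \<eta>. \<Sum>l\<in>Qgrid \<eta>. phase \<eta> (s * iwedge j k) * phase \<eta> (s * iwedge k l) * x l)"
    by (simp add: dft_def sum_distrib_left mult.assoc)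
  also have "\<dots> = (\<Sum>l\<in>Qgrid \<eta>. (\<Sum>k\<in>Qgrid \<eta>. phase \<eta> (s * iwedge j k) * phase \<eta> (s * iwedge k l)) * x l)"
    unfolding sum_distrib_right by (rule sum.swap)
  also have "\<dots> = (\<Sum>l\<in>Qgrid \<eta>. (if j = l then of_nat (\<eta>\<^sup>2) * x l else 0))"
    by (intro sum.cong refl) (simp add: phase_orthogonality assms)
  also have "\<dots> = of_nat (\<eta>\<^sup>2) * x j"
    using assms(2) by simp
  finally show ?thesis
    by (simp add: scaleR_conv_of_real)
qed

text \<open>The adjoint of multiplication by a phase is multiplication by the conjugate phase, and
  conjugating exchanges the arguments of the wedge; the transform is therefore self-adjoint.\<close>

lemma inner_dft:
  "(\<Sum>j\<in>Qgrid \<eta>. inner (dft \<eta> s x j) (y j)) = (\<Sum>k\<in>Qgrid \<eta>. inner (x k) (dft \<eta> s y k))"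
proof -
  have "inner (phase \<eta> (s * iwedge j k) * x k) (y j) = inner (x k) (phase \<eta> (s * iwedge k j) * y j)" for j k
    by (simp add: inner_phase_mult iwedge_commute[of k j])
  then have "(\<Sum>j\<in>Qgrid \<eta>. inner (dft \<eta> s x j) (y j)) =
      (\<Sum>j\<in>Qgrid \<eta>. \<Sum>k\<in>Qgrid \<eta>. inner (x k) (phase \<eta> (s * iwedge k j) * y j))"
    by (simp add: dft_def inner_sum_left)
  also have "\<dots> = (\<Sum>k\<in>Qgrid \<eta>. \<Sum>j\<in>Qgrid \<eta>. inner (x k) (phase \<eta> (s * iwedge k j) * y j))"
    by (rule sum.swap)
  finally show ?thesis
    by (simp add: dft_def inner_sum_right)
qed

lemma dft_parseval:
  assumes "\<eta> > 0" "\<bar>s\<bar> = 1"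
  shows "(\<Sum>j\<in>Qgrid \<eta>. inner (dft \<eta> s x j) (dft \<eta> s y j)) = (real \<eta>)\<^sup>2 * (\<Sum>k\<in>Qgrid \<eta>. inner (x k) (y k))"
  by (simp add: inner_dft dft_dft assms sum_distrib_left)

abbreviation shift1 :: "nat \<Rightarrow> nat \<times> nat \<Rightarrow> nat \<times> nat" where
  "shift1 \<eta> j \<equiv> red \<eta> (fst j + \<eta> div 2, snd j)"

abbreviation shift2 :: "nat \<Rightarrow> nat \<times> nat \<Rightarrow> nat \<times> nat" where
  "shift2 \<eta> j \<equiv> red \<eta> (fst j, snd j + \<eta> div 2)"

abbreviation reflect :: "nat \<Rightarrow> nat \<times> nat \<Rightarrow> nat \<times> nat" where
  "reflect \<eta> j \<equiv> red \<eta> (\<eta> - fst j, \<eta> - snd j)"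

lemma red_in_Qgrid: "\<eta> > 0 \<Longrightarrow> red \<eta> j \<in> Qgrid \<eta>"
  by (simp add: red_def Qgrid_def)

lemma phase_red:
  assumes "\<eta> > 0" shows "phase \<eta> (s * iwedge (red \<eta> j) k) = phase \<eta> (s * iwedge j k)"
proof -
  have "iwedge j k = iwedge (red \<eta> j) k + int \<eta> *
      (int (fst j div \<eta>) * int (snd k) - int (snd j div \<eta>) * int (fst k))"
    (is "_ = _ + int \<eta> * ?t")
  proof -
    have "int (fst j) = int \<eta> * int (fst j div \<eta>) + int (fst j mod \<eta>)"
      "int (snd j) = int \<eta> * int (snd j div \<eta>) + int (snd j mod \<eta>)"
      by (simp_all flip: of_nat_mult of_nat_add)
    moreover have "x * u - y * v = x' * u - y' * v + e * (p * u - q * v)"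
      if "x = e * p + x'" "y = e * q + y'" for x y x' y' u v p q e :: int
      by (simp add: that algebra_simps)
    ultimately show ?thesis
      unfolding iwedge_def red_def fst_conv snd_conv by blast
  qed
  then have "s * iwedge j k = s * iwedge (red \<eta> j) k + int \<eta> * (s * ?t)"
    by (metis distrib_left mult.left_commute)
  then show ?thesis
    by (simp add: phase_add phase_period[OF assms])
qed

text \<open>Shifting \<open>j\<close> by half a period in one coordinate adds half a period times the other
  coordinate of \<open>k\<close> to the wedge.\<close>

lemma phase_shift:
  assumes "\<eta> > 0" "even \<eta>" "\<bar>s\<bar> = 1"
  shows "phase \<eta> (s * iwedge (shift1 \<eta> j) k) = (- 1) ^ snd k * phase \<eta> (s * iwedge j k)"
    and "phase \<eta> (s * iwedge (shift2 \<eta> j) k) = (- 1) ^ fst k * phase \<eta> (s * iwedge j k)"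
proof -
  have s: "odd s" using assms(3) by presburger
  have "s * iwedge (fst j + \<eta> div 2, snd j) k = int (\<eta> div 2) * (s * int (snd k)) + s * iwedge j k"
    by (simp add: iwedge_def algebra_simps)
  then show "phase \<eta> (s * iwedge (shift1 \<eta> j) k) = (- 1) ^ snd k * phase \<eta> (s * iwedge j k)"
    using s by (simp add: phase_red phase_add phase_half assms(1,2))
  have "s * iwedge (fst j, snd j + \<eta> div 2) k = int (\<eta> div 2) * (- s * int (fst k)) + s * iwedge j k"
    by (simp add: iwedge_def algebra_simps)
  then show "phase \<eta> (s * iwedge (shift2 \<eta> j) k) = (- 1) ^ fst k * phase \<eta> (s * iwedge j k)"
    using s by (simp add: phase_red phase_add phase_half assms(1,2) del: mult_minus_left)
qed

lemma phase_reflect: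
  assumes "\<eta> > 0" "j \<in> Qgrid \<eta>"
  shows "phase \<eta> (s * iwedge (reflect \<eta> j) k) = phase \<eta> (- s * iwedge j k)"
proof -
  have "s * iwedge (\<eta> - fst j, \<eta> - snd j) k =
      int \<eta> * (s * (int (snd k) - int (fst k))) + - s * iwedge j k"
    using assms(2) by (auto simp: iwedge_def Qgrid_def of_nat_diff algebra_simps)
  then show ?thesis
    by (simp only: phase_red[OF assms(1)] phase_add phase_period[OF assms(1)] mult_1)
qed

lemma sum_Qgrid_involution:
  fixes f :: "nat \<times> nat \<Rightarrow> quat"
  assumes "\<And>j. j \<in> Qgrid \<eta> \<Longrightarrow> h j \<in> Qgrid \<eta> \<and> h (h j) = j"
  shows "(\<Sum>j\<in>Qgrid \<eta>. f j) = (\<Sum>j\<in>Qgrid \<eta>. f (h j))"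
  using assms by (intro sum.reindex_bij_witness[of _ h h]) auto

lemma symmetries_involutive:
  assumes "\<eta> > 0" "even \<eta>" "j \<in> Qgrid \<eta>"
  shows "shift1 \<eta> (shift1 \<eta> j) = j" "shift2 \<eta> (shift2 \<eta> j) = j" "reflect \<eta> (reflect \<eta> j) = j"
proof -
  have half: "((m + \<eta> div 2) mod \<eta> + \<eta> div 2) mod \<eta> = m" if "m < \<eta>" for m
  proof -
    have "((m + \<eta> div 2) mod \<eta> + \<eta> div 2) mod \<eta> = (m + (\<eta> div 2 + \<eta> div 2)) mod \<eta>"
      by (simp add: mod_add_left_eq add.assoc)
    also have "\<eta> div 2 + \<eta> div 2 = \<eta>"
      using assms(2) by auto
    finally show ?thesis using that by simp
  qed
  have neg: "(\<eta> - (\<eta> - m) mod \<eta>) mod \<eta> = m" if "m < \<eta>" for m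
    using that by (cases "m = 0") auto
  show "shift1 \<eta> (shift1 \<eta> j) = j" "shift2 \<eta> (shift2 \<eta> j) = j" "reflect \<eta> (reflect \<eta> j) = j"
    using assms(3) half neg by (auto simp: red_def Qgrid_def)
qed

lemma dft_symmetries:
  assumes "\<eta> > 0" "even \<eta>" "j \<in> Qgrid \<eta>" "\<bar>s\<bar> = 1"
  shows "dft \<eta> s x (shift1 \<eta> j) = dft \<eta> s (\<lambda>k. (- 1) ^ snd k *\<^sub>R x k) j"
    and "dft \<eta> s x (shift2 \<eta> j) = dft \<eta> s (\<lambda>k. (- 1) ^ fst k *\<^sub>R x k) j"
    and "dft \<eta> s x (reflect \<eta> j) = dft \<eta> (- s) x j"
proof -
  have *: "(- 1) ^ n * p * y = p * ((- 1) ^ n *\<^sub>R y)" for n :: nat and p y :: quat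
    by (cases "even n") simp_all
  show "dft \<eta> s x (shift1 \<eta> j) = dft \<eta> s (\<lambda>k. (- 1) ^ snd k *\<^sub>R x k) j"
    and "dft \<eta> s x (shift2 \<eta> j) = dft \<eta> s (\<lambda>k. (- 1) ^ fst k *\<^sub>R x k) j"
    unfolding dft_def phase_shift[OF assms(1,2,4)] * by (rule refl)+
  show "dft \<eta> s x (reflect \<eta> j) = dft \<eta> (- s) x j"
    unfolding dft_def phase_reflect[OF assms(1,3)] by (rule refl)
qed

text \<open>Each symmetry is an involution of the grid, so summing over the transformed index moves it
  from the samples to the phase.\<close>

lemma dft_of_symmetric:
  assumes "\<eta> > 0" "even \<eta>" "\<bar>s\<bar> = 1"
  shows "dft \<eta> s (\<lambda>j. x (shift1 \<eta> j)) k = (- 1) ^ snd k *\<^sub>R dft \<eta> s x k"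
    and "dft \<eta> s (\<lambda>j. x (shift2 \<eta> j)) k = (- 1) ^ fst k *\<^sub>R dft \<eta> s x k"
    and "dft \<eta> s (\<lambda>j. x (reflect \<eta> j)) k = dft \<eta> (- s) x k"
proof -
  have swap: "phase \<eta> (s * iwedge k j) = phase \<eta> (- s * iwedge j k)" for s j
    by (simp add: iwedge_commute[of k j])
  have scale: "(- 1) ^ n *\<^sub>R y = (- 1) ^ n * y" for n :: nat and y :: quat
    by (cases "even n") simp_all
  have sq: "(- 1) ^ n * ((- 1) ^ n * y) = y" for n :: nat and y :: quat
    by (cases "even n") simp_all
  have s: "\<bar>- s\<bar> = 1" using assms(3) by simp
  show "dft \<eta> s (\<lambda>j. x (shift1 \<eta> j)) k = (- 1) ^ snd k *\<^sub>R dft \<eta> s x k"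
    unfolding dft_def
    by (subst (2) sum_Qgrid_involution[where h = "shift1 \<eta>"])
       (simp_all add: symmetries_involutive red_in_Qgrid assms swap phase_shift[OF assms(1,2) s]
          scale sq sum_distrib_left mult.assoc del: mult_minus_left)
  show "dft \<eta> s (\<lambda>j. x (shift2 \<eta> j)) k = (- 1) ^ fst k *\<^sub>R dft \<eta> s x k"
    unfolding dft_def
    by (subst (2) sum_Qgrid_involution[where h = "shift2 \<eta>"])
       (simp_all add: symmetries_involutive red_in_Qgrid assms swap phase_shift[OF assms(1,2) s]
          scale sq sum_distrib_left mult.assoc del: mult_minus_left)
  show "dft \<eta> s (\<lambda>j. x (reflect \<eta> j)) k = dft \<eta> (- s) x k"
    unfolding dft_def
    by (subst (2) sum_Qgrid_involution[where h = "reflect \<eta>"])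
       (simp_all add: symmetries_involutive red_in_Qgrid assms swap phase_reflect del: mult_minus_left)
qed

definition row_sign :: "nat \<Rightarrow> int" where
  "row_sign r = (if even r then 1 else - 1)"

lemma abs_row_sign [simp]: "\<bar>row_sign r\<bar> = 1"
  by (simp add: row_sign_def)

lemma row_sign_mod_2 [simp]: "row_sign (r mod 2) = row_sign r"
  by (simp add: row_sign_def)

definition diag2 :: "(nat \<Rightarrow> quat) \<Rightarrow> quat mat" where
  "diag2 d = mat 2 2 (\<lambda>(r, c). if r = c then d r else 0)"

lemma exp_bracket_phase:
  "exp_bracket (of_real (2 * pi / real \<eta>) * wedge_nat j k) = diag2 (\<lambda>r. phase \<eta> (row_sign r * iwedge j k))"
proof -
  have "exp (of_real (2 * pi / real \<eta>) * wedge_nat j k) = phase \<eta> (iwedge j k)"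
    "exp (- (of_real (2 * pi / real \<eta>) * wedge_nat j k)) = phase \<eta> (- iwedge j k)"
  proof -
    have x: "of_real (2 * pi / real \<eta>) * wedge_nat j k
        = quat_of_complex (\<i> * of_real (2 * pi * of_int (iwedge j k) / real \<eta>))"
    proof -
      have "wedge_nat j k = of_real (of_int (iwedge j k)) * e12"
        by (simp add: wedge_nat_def wedge_def iwedge_def)
      moreover have "of_real c * (of_real d * e12) = quat_of_complex (\<i> * of_real (c * d))" for c d
        by (simp add: quat_eq_iff e12_def)
      ultimately show ?thesis
        by (simp only: times_divide_eq_left)
    qed
    have "- (of_real (2 * pi / real \<eta>) * wedge_nat j k)
        = quat_of_complex (\<i> * of_real (2 * pi * of_int (- iwedge j k) / real \<eta>))"
      unfolding x by (simp add: quat_eq_iff)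
    with x show "exp (of_real (2 * pi / real \<eta>) * wedge_nat j k) = phase \<eta> (iwedge j k)"
      "exp (- (of_real (2 * pi / real \<eta>) * wedge_nat j k)) = phase \<eta> (- iwedge j k)"
      by (simp_all only: exp_quat_of_complex phase_def cis_conv_exp)
  qed
  then show ?thesis
    by (intro eq_matI) (auto simp: exp_bracket_def diag2_def mat_of_rows_list_def row_sign_def
        numeral_2_eq_2 less_Suc_eq)
qed

lemma block_act_diag2:
  assumes "A \<in> carrier_mat (2 * m) (2 * n)" "r < 2 * m" "c < 2 * n"
  shows "(diag2 d \<circledast> A) $$ (r, c) = d (r mod 2) * A $$ (r, c)"
proof -
  have "r mod 2 < 2" "c mod 2 < 2" by simp_all
  then show ?thesis
    using assms by (simp add: block_act_def diag2_def blk_def scalar_prod_def if_distrib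
        if_distribR sum.delta cong: if_cong)
qed

lemma Fourier_index:
  assumes "\<And>k. k \<in> Qgrid \<eta> \<Longrightarrow> B k \<in> carrier_mat 8 8" "j \<in> Qgrid \<eta>" "r < 8" "c < 8"
  shows "Fourier \<eta> B j $$ (r, c) = dft \<eta> (row_sign r) (\<lambda>k. B k $$ (r, c)) j"
  using assms block_act_diag2[of _ 4 4 r c]
  by (simp add: Fourier_def mat_sum_def dft_def exp_bracket_phase)

lemma Fourier_inv_index:
  assumes "\<And>k. k \<in> Qgrid \<eta> \<Longrightarrow> B k \<in> carrier_mat 8 8" "j \<in> Qgrid \<eta>" "r < 8" "c < 8"
  shows "Fourier_inv \<eta> B j $$ (r, c) = (1 / (real \<eta>)\<^sup>2) *\<^sub>R dft \<eta> (row_sign r) (\<lambda>k. B k $$ (r, c)) j"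
  using assms block_act_diag2[of _ 4 4 r c]
  by (simp add: Fourier_inv_def mat_sum_def dft_def exp_bracket_phase scaleR_conv_of_real)

lemma Fourier_carrier: "Fourier \<eta> B \<in> Qgrid \<eta> \<rightarrow>\<^sub>E carrier_mat 8 8"
  by (simp add: Fourier_def mat_sum_def)

lemma Fourier_inv_carrier: "Fourier_inv \<eta> B \<in> Qgrid \<eta> \<rightarrow>\<^sub>E carrier_mat 8 8"
  by (simp add: Fourier_inv_def mat_sum_def)

lemma ensemble_eqI:
  assumes "A \<in> Qgrid \<eta> \<rightarrow>\<^sub>E carrier_mat 8 8" "B \<in> Qgrid \<eta> \<rightarrow>\<^sub>E carrier_mat 8 8"
    and "\<And>k r c. k \<in> Qgrid \<eta> \<Longrightarrow> r < 8 \<Longrightarrow> c < 8 \<Longrightarrow> A k $$ (r, c) = B k $$ (r, c)"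
  shows "A = B"
proof (rule PiE_ext[OF assms(1,2)])
  fix k assume "k \<in> Qgrid \<eta>"
  moreover from this have "A k \<in> carrier_mat 8 8" "B k \<in> carrier_mat 8 8"
    using assms(1,2) by auto
  ultimately show "A k = B k"
    using assms(3) by (intro eq_matI) auto
qed

lemma Fourier_Fourier_inv:
  assumes "\<eta> > 0" "B \<in> Qgrid \<eta> \<rightarrow>\<^sub>E carrier_mat 8 8"
  shows "Fourier \<eta> (Fourier_inv \<eta> B) = B"
proof (rule ensemble_eqI[OF Fourier_carrier assms(2)])
  fix k and r c :: nat assume *: "k \<in> Qgrid \<eta>" "r < 8" "c < 8"
  have B: "B k \<in> carrier_mat 8 8" "Fourier_inv \<eta> B k \<in> carrier_mat 8 8" if "k \<in> Qgrid \<eta>" for k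
    using assms(2) that Fourier_inv_carrier[of \<eta> B] by auto
  have "Fourier \<eta> (Fourier_inv \<eta> B) k $$ (r, c) = dft \<eta> (row_sign r)
      (\<lambda>k. (1 / (real \<eta>)\<^sup>2) *\<^sub>R dft \<eta> (row_sign r) (\<lambda>k. B k $$ (r, c)) k) k"
    by (subst Fourier_index) (use * B in \<open>auto intro!: dft_cong Fourier_inv_index\<close>)
  also have "\<dots> = B k $$ (r, c)"
    using assms(1) * by (simp add: dft_scaleR dft_dft)
  finally show "Fourier \<eta> (Fourier_inv \<eta> B) k $$ (r, c) = B k $$ (r, c)" .
qed

section \<open>The module in Fourier coordinates\<close>

text \<open>The sign of the block row \<open>p = 2 p\<^sub>2 + p\<^sub>1\<close> relative to the first one: the factor
  \<open>(-1)\<^bsup>k\<^sub>2\<^esup>\<close> comes from \<open>\<sigma>\<^sub>1\<close>, the factor \<open>(-1)\<^bsup>k\<^sub>1\<^esup>\<close> from \<open>\<sigma>\<^sub>2\<close>.\<close>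

definition block_sign :: "nat \<times> nat \<Rightarrow> nat \<Rightarrow> real" where
  "block_sign k p = (- 1) ^ (snd k * (p mod 2) + fst k * (p div 2))"

text \<open>The Fourier coefficients of a member of the module are determined by four free quaternions
  per frequency. Entry \<open>(0, 2 q)\<close> is a spinor and \<open>(0, 2 q + 1)\<close> a vector, so they pack into the single
  quaternion \<open>a k q\<close>; the other rows repeat these entries up to sign, the odd ones with the two columns of
  each block exchanged.\<close>

definition spectrum :: "nat \<Rightarrow> (nat \<times> nat \<Rightarrow> nat \<Rightarrow> quat) \<Rightarrow> ensemble" where
  "spectrum \<eta> a = (\<lambda>k\<in>Qgrid \<eta>. mat 8 8 (\<lambda>(r, c).
     block_sign k (r div 2) *\<^sub>R graded_part (r + c) (a k (c div 2))))"

definition first_row :: "ensemble \<Rightarrow> nat \<times> nat \<Rightarrow> nat \<Rightarrow> quat" where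
  "first_row B k q = B k $$ (0, 2 * q) + B k $$ (0, 2 * q + 1)"

lemma block_sign_simps [simp]:
  "block_sign k 0 = 1" "block_sign k 1 = (- 1) ^ snd k" "block_sign k (Suc 0) = (- 1) ^ snd k"
  "block_sign k 2 = (- 1) ^ fst k" "block_sign k 3 = (- 1) ^ (fst k + snd k)"
  by (simp_all add: block_sign_def add.commute)

lemma block_sign_square: "block_sign k p * block_sign k p = 1"
  by (simp add: block_sign_def flip: power_add mult_2)

lemma spectrum_carrier: "spectrum \<eta> a \<in> Qgrid \<eta> \<rightarrow>\<^sub>E carrier_mat 8 8"
  by (simp add: spectrum_def)

lemma spectrum_carrier_at [simp]: "k \<in> Qgrid \<eta> \<Longrightarrow> spectrum \<eta> a k \<in> carrier_mat 8 8"
  by (simp add: spectrum_def)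

lemma spectrum_index:
  "k \<in> Qgrid \<eta> \<Longrightarrow> r < 8 \<Longrightarrow> c < 8 \<Longrightarrow> spectrum \<eta> a k $$ (r, c) =
     block_sign k (r div 2) *\<^sub>R graded_part (r + c) (a k (c div 2))"
  by (simp add: spectrum_def)

lemma graded_part_fixed:
  assumes "graded_part d' x = x"
  shows "graded_part d x = (if even d = even d' then x else 0)"
  using graded_part_idem[of d d' x] graded_part_parity[of d d'] assms by (auto split: if_splits)

lemma less_8_cases:
  fixes r :: nat
  assumes "r < 8" obtains "r = 0" | "r = 1" | "r = 2" | "r = 3" | "r = 4" | "r = 5" | "r = 6" | "r = 7"
  using assms by linarith

text \<open>The given relations propagate the first row to row 1, from there to rows 2 and 3, and then
  to rows 4 to 7. They hold both for the coefficients of a member of the module and, by definition,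
  for the corrected coefficients of the theorem.\<close>

lemma spectrumI:
  assumes A: "A \<in> Qgrid \<eta> \<rightarrow>\<^sub>E carrier_mat 8 8"
    and even_col: "\<And>k q. k \<in> Qgrid \<eta> \<Longrightarrow> q < 4 \<Longrightarrow> graded_part 0 (A k $$ (0, 2 * q)) = A k $$ (0, 2 * q)"
    and odd_col: "\<And>k q. k \<in> Qgrid \<eta> \<Longrightarrow> q < 4 \<Longrightarrow> graded_part 1 (A k $$ (0, 2 * q + 1)) = A k $$ (0, 2 * q + 1)"
    and row1: "\<And>k q. k \<in> Qgrid \<eta> \<Longrightarrow> q < 4 \<Longrightarrow>
      A k $$ (1, 2 * q) = A k $$ (0, 2 * q + 1) \<and> A k $$ (1, 2 * q + 1) = A k $$ (0, 2 * q)"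
    and rows23: "\<And>k r c. k \<in> Qgrid \<eta> \<Longrightarrow> r < 2 \<Longrightarrow> c < 8 \<Longrightarrow>
      A k $$ (2 + r, c) = (- 1) ^ snd k *\<^sub>R A k $$ (r, c)"
    and rows4567: "\<And>k r c. k \<in> Qgrid \<eta> \<Longrightarrow> r < 4 \<Longrightarrow> c < 8 \<Longrightarrow>
      A k $$ (4 + r, c) = (- 1) ^ fst k *\<^sub>R A k $$ (r, c)"
  shows "A = spectrum \<eta> (first_row A)"
proof (rule ensemble_eqI[OF A spectrum_carrier])
  fix k and r c :: nat assume k: "k \<in> Qgrid \<eta>" and r: "r < 8" and c: "c < 8"
  define q where "q = c div 2"
  have q: "q < 4" and cq: "c = 2 * q \<or> c = 2 * q + 1"
    using c by (auto simp: q_def)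
  have col: "graded_part d (A k $$ (0, 2 * q)) = (if even d then A k $$ (0, 2 * q) else 0)"
    "graded_part d (A k $$ (0, 2 * q + 1)) = (if even d then 0 else A k $$ (0, 2 * q + 1))" for d
  proof -
    show "graded_part d (A k $$ (0, 2 * q)) = (if even d then A k $$ (0, 2 * q) else 0)"
      by (simp add: graded_part_fixed[OF even_col[OF k q]])
    show "graded_part d (A k $$ (0, 2 * q + 1)) = (if even d then 0 else A k $$ (0, 2 * q + 1))"
      by (subst graded_part_fixed[OF odd_col[OF k q]]) simp
  qed
  have fr: "graded_part d (first_row A k q) = (if even d then A k $$ (0, 2 * q) else A k $$ (0, 2 * q + 1))" for d
    unfolding first_row_def graded_part_simps col by simp
  have r01: "A k $$ (r, c) = graded_part (r + c) (first_row A k q)" if "r < 2" for r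
  proof -
    from that have "r = 0 \<or> r = 1" by auto
    then show ?thesis using cq row1[OF k q] by (auto simp: fr)
  qed
  have r23: "A k $$ (2 + r, c) = (- 1) ^ snd k *\<^sub>R graded_part (r + c) (first_row A k q)" if "r < 2" for r
    using rows23[OF k that c] r01[OF that] by simp
  have r4: "A k $$ (r, c) = block_sign k (r div 2) *\<^sub>R graded_part (r + c) (first_row A k q)" if "r < 4" for r
  proof (cases "r < 2")
    case True
    then show ?thesis using r01 by simp
  next
    case False
    then have "r - 2 < 2" "r = 2 + (r - 2)" "r div 2 = 1" using that by auto
    moreover have "graded_part (r - 2 + c) = graded_part (r + c)"
      using False by (intro graded_part_parity) auto
    ultimately show ?thesis using r23[of "r - 2"] by simp
  qed
  have "A k $$ (r, c) = block_sign k (r div 2) *\<^sub>R graded_part (r + c) (first_row A k q)"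
  proof (cases "r < 4")
    case False
    then have *: "r - 4 < 4" "r = 4 + (r - 4)" "r div 2 = 2 + (r - 4) div 2" using r by auto
    have "graded_part (r - 4 + c) = graded_part (r + c)"
      using False by (intro graded_part_parity) auto
    moreover have "(- 1) ^ fst k * block_sign k ((r - 4) div 2) = block_sign k (r div 2)"
    proof -
      have "(r - 4) div 2 = 0 \<or> (r - 4) div 2 = 1" using *(1) by auto
      then show ?thesis unfolding *(3) by (auto simp: block_sign_def power_add)
    qed
    ultimately show ?thesis
      using rows4567[OF k *(1) c] r4[OF *(1)] *(2) by simp
  qed (rule r4)
  then show "A k $$ (r, c) = spectrum \<eta> (first_row A) k $$ (r, c)"
    by (simp add: spectrum_index k r c q_def)
qed

text \<open>The matrices \<open>\<tau>\<close>, \<open>\<sigma>\<^sub>1\<close> and \<open>\<sigma>\<^sub>2\<close> permute the eight rows by flipping one binary digit of the row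
  index: the units, the twos and the fours digit respectively.\<close>

definition swap1 :: "nat \<Rightarrow> nat" where
  "swap1 r = (if even r then r + 1 else r - 1)"

definition swap2 :: "nat \<Rightarrow> nat" where
  "swap2 r = (if even (r div 2) then r + 2 else r - 2)"

definition swap4 :: "nat \<Rightarrow> nat" where
  "swap4 r = (if r < 4 then r + 4 else r - 4)"

lemma swap_simps [simp]:
  "swap1 0 = 1" "swap1 1 = 0" "swap1 (Suc 0) = 0" "swap1 2 = 3" "swap1 3 = 2" "swap1 4 = 5" "swap1 5 = 4" "swap1 6 = 7" "swap1 7 = 6"
  "swap2 0 = 2" "swap2 1 = 3" "swap2 (Suc 0) = 3" "swap2 2 = 0" "swap2 3 = 1" "swap2 4 = 6" "swap2 5 = 7" "swap2 6 = 4" "swap2 7 = 5"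
  "swap4 0 = 4" "swap4 1 = 5" "swap4 (Suc 0) = 5" "swap4 2 = 6" "swap4 3 = 7" "swap4 4 = 0" "swap4 5 = 1" "swap4 6 = 2" "swap4 7 = 3"
  by (simp_all add: swap1_def swap2_def swap4_def)

lemma swap_less_8: "r < 8 \<Longrightarrow> swap1 r < 8" "r < 8 \<Longrightarrow> swap2 r < 8" "r < 8 \<Longrightarrow> swap4 r < 8"
  by (erule less_8_cases; simp)+

lemma swap_involutive:
  "r < 8 \<Longrightarrow> swap1 (swap1 r) = r"
  by (erule less_8_cases; simp)

lemma symmetry_mats:
  "sigma1 = mat 8 8 (\<lambda>(r, i). if i = swap2 r then 1 else 0)"
  "sigma2 = mat 8 8 (\<lambda>(r, i). if i = swap4 r then 1 else 0)"
  "tau = mat 8 8 (\<lambda>(r, i). if i = swap1 r then 1 else 0)"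
proof -
  have "sigma1 $$ (r, i) = (if i = swap2 r then 1 else 0)" if "r < 8" "i < 8" for r i
    using that by (elim less_8_cases; simp add: sigma1_def inflate_def mat_of_rows_list_def)
  then show "sigma1 = mat 8 8 (\<lambda>(r, i). if i = swap2 r then 1 else 0)"
    by (intro eq_matI) (simp_all add: sigma1_def inflate_def mat_of_rows_list_def)
  have "sigma2 $$ (r, i) = (if i = swap4 r then 1 else 0)" if "r < 8" "i < 8" for r i
    using that by (elim less_8_cases; simp add: sigma2_def inflate_def mat_of_rows_list_def)
  then show "sigma2 = mat 8 8 (\<lambda>(r, i). if i = swap4 r then 1 else 0)"
    by (intro eq_matI) (simp_all add: sigma2_def inflate_def mat_of_rows_list_def)
  have tau0: "tau0 = mat 2 2 (\<lambda>(r, i). if i = swap1 r then 1 else 0)"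
    by (rule eq_matI) (auto simp: tau0_def mat_of_rows_list_def numeral_2_eq_2 less_Suc_eq)
  have "tau $$ (r, i) = (if i = swap1 r then 1 else 0)" if "r < 8" "i < 8" for r i
    using that by (elim less_8_cases; simp add: tau_def tau0 Let_def)
  then show "tau = mat 8 8 (\<lambda>(r, i). if i = swap1 r then 1 else 0)"
    by (intro eq_matI) (simp_all add: tau_def tau0 Let_def)
qed

lemma permutation_mat_mult:
  fixes B :: "quat mat"
  assumes "B \<in> carrier_mat 8 8" "\<And>r. r < 8 \<Longrightarrow> f r < 8" "r < 8" "c < 8"
  shows "(mat 8 8 (\<lambda>(r, i). if i = f r then 1 else 0) * B) $$ (r, c) = B $$ (f r, c)"
proof -
  have "(mat 8 8 (\<lambda>(r, i). if i = f r then 1 else 0) * B) $$ (r, c) =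
      (\<Sum>i = 0..<8. (if i = f r then B $$ (i, c) else 0))"
    using assms by (simp add: scalar_prod_def if_distrib[of "\<lambda>x. x * _"] cong: if_cong)
  then show ?thesis using assms by simp
qed

lemma mult_permutation_mat:
  fixes B :: "quat mat"
  assumes "B \<in> carrier_mat 8 8" "\<And>r. r < 8 \<Longrightarrow> f r < 8 \<and> f (f r) = r" "r < 8" "c < 8"
  shows "(B * mat 8 8 (\<lambda>(r, i). if i = f r then 1 else 0)) $$ (r, c) = B $$ (r, f c)"
proof -
  have "(B * mat 8 8 (\<lambda>(r, i). if i = f r then 1 else 0)) $$ (r, c) =
      (\<Sum>i = 0..<8. B $$ (r, i) * (if c = f i then 1 else 0))"
    using assms by (simp add: scalar_prod_def)
  also have "\<dots> = (\<Sum>i = 0..<8. (if i = f c then B $$ (r, i) else 0))"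
    using assms(2,4) by (intro sum.cong) auto
  finally show ?thesis using assms by simp
qed

lemma H_module_iff:
  "B \<in> H_module \<eta> \<longleftrightarrow> B \<in> Qgrid \<eta> \<rightarrow>\<^sub>E carrier_mat 8 8 \<and>
     (\<forall>j\<in>Qgrid \<eta>. \<forall>r<8. \<forall>c<8. graded_part (r + c) (B j $$ (r, c)) = B j $$ (r, c)) \<and>
     (\<forall>j\<in>Qgrid \<eta>. \<forall>r<8. \<forall>c<8.
        B (shift1 \<eta> j) $$ (r, c) = B j $$ (swap2 r, c) \<and>
        B (shift2 \<eta> j) $$ (r, c) = B j $$ (swap4 r, c) \<and>
        B (reflect \<eta> j) $$ (r, c) = B j $$ (swap1 r, swap1 c))"
proof -
  have smat: "B \<in> Qgrid \<eta> \<rightarrow>\<^sub>E S_mat 4 \<longleftrightarrow> B \<in> Qgrid \<eta> \<rightarrow>\<^sub>E carrier_mat 8 8 \<and>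
     (\<forall>j\<in>Qgrid \<eta>. \<forall>r<8. \<forall>c<8. graded_part (r + c) (B j $$ (r, c)) = B j $$ (r, c))"
    by (auto simp: PiE_iff S_mat_iff)
  have sym: "(B (shift1 \<eta> j) = sigma1 * B j \<and> B (shift2 \<eta> j) = sigma2 * B j \<and>
      B (reflect \<eta> j) = tau * B j * tau) \<longleftrightarrow> (\<forall>r<8. \<forall>c<8.
        B (shift1 \<eta> j) $$ (r, c) = B j $$ (swap2 r, c) \<and>
        B (shift2 \<eta> j) $$ (r, c) = B j $$ (swap4 r, c) \<and>
        B (reflect \<eta> j) $$ (r, c) = B j $$ (swap1 r, swap1 c))"
    if B: "B \<in> Qgrid \<eta> \<rightarrow>\<^sub>E carrier_mat 8 8" and j: "j \<in> Qgrid \<eta>" for j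
  proof -
    have "\<eta> > 0" using j by (auto simp: Qgrid_def)
    then have car: "B j \<in> carrier_mat 8 8" "B (shift1 \<eta> j) \<in> carrier_mat 8 8"
      "B (shift2 \<eta> j) \<in> carrier_mat 8 8" "B (reflect \<eta> j) \<in> carrier_mat 8 8"
      using B j red_in_Qgrid[of \<eta>] by blast+
    have eq8: "X = Y \<longleftrightarrow> (\<forall>r<8. \<forall>c<8. X $$ (r, c) = Y $$ (r, c))"
      if "X \<in> carrier_mat 8 8" "Y \<in> carrier_mat 8 8" for X Y :: "quat mat"
      using that by (auto intro!: eq_matI)
    have car2: "sigma1 * B j \<in> carrier_mat 8 8" "sigma2 * B j \<in> carrier_mat 8 8"
      "tau * B j \<in> carrier_mat 8 8" "tau * B j * tau \<in> carrier_mat 8 8"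
      using car(1) by (auto simp: symmetry_mats)
    have "(sigma1 * B j) $$ (r, c) = B j $$ (swap2 r, c)" "(sigma2 * B j) $$ (r, c) = B j $$ (swap4 r, c)"
      "(tau * B j * tau) $$ (r, c) = B j $$ (swap1 r, swap1 c)" if "r < 8" "c < 8" for r c
    proof -
      show "(sigma1 * B j) $$ (r, c) = B j $$ (swap2 r, c)" "(sigma2 * B j) $$ (r, c) = B j $$ (swap4 r, c)"
        unfolding symmetry_mats
        by (rule permutation_mat_mult[OF car(1) _ that]; simp add: swap_less_8)+
      have "(tau * B j * tau) $$ (r, c) = (tau * B j) $$ (r, swap1 c)"
        using mult_permutation_mat[OF car2(3), of swap1 r c] that swap_less_8(1) swap_involutive
        by (simp flip: symmetry_mats)
      also have "\<dots> = B j $$ (swap1 r, swap1 c)"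
        using permutation_mat_mult[OF car(1), of swap1 r "swap1 c"] that swap_less_8(1)
        by (simp flip: symmetry_mats)
      finally show "(tau * B j * tau) $$ (r, c) = B j $$ (swap1 r, swap1 c)" .
    qed
    then show ?thesis
      using eq8[OF car(2) car2(1)] eq8[OF car(3) car2(2)] eq8[OF car(4) car2(4)] by auto
  qed
  show ?thesis
    unfolding H_module_def mem_Collect_eq smat using sym by blast
qed

text \<open>The flip of the units digit exchanges the two phases of a block; it is compensated by the
  reflection of the sample index, which conjugates the phase.\<close>

lemma row_sign_swap:
  "r < 8 \<Longrightarrow> row_sign (swap2 r) = row_sign r" "r < 8 \<Longrightarrow> row_sign (swap4 r) = row_sign r"
  "r < 8 \<Longrightarrow> row_sign (swap1 r) = - row_sign r"
  by (erule less_8_cases; simp add: row_sign_def)+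

lemma spectrum_symmetries:
  assumes k: "k \<in> Qgrid \<eta>" and r: "r < 8" and c: "c < 8"
  shows "(- 1) ^ snd k *\<^sub>R spectrum \<eta> a k $$ (r, c) = spectrum \<eta> a k $$ (swap2 r, c)"
    and "(- 1) ^ fst k *\<^sub>R spectrum \<eta> a k $$ (r, c) = spectrum \<eta> a k $$ (swap4 r, c)"
    and "spectrum \<eta> a k $$ (swap1 r, swap1 c) = spectrum \<eta> a k $$ (r, c)"
proof -
  have par: "graded_part (swap2 r + c) = graded_part (r + c)" "graded_part (swap4 r + c) = graded_part (r + c)"
    "graded_part (swap1 r + swap1 c) = graded_part (r + c)"
    by (rule graded_part_parity; use r c in \<open>auto simp: swap1_def swap2_def swap4_def\<close>)+
  have swap1_div: "swap1 n div 2 = n div 2" if "n < 8" for n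
    using that by (elim less_8_cases) simp_all
  have sign: "(- 1) ^ snd k * block_sign k (r div 2) = block_sign k (swap2 r div 2)"
    "(- 1) ^ fst k * block_sign k (r div 2) = block_sign k (swap4 r div 2)"
    using r by (elim less_8_cases; simp add: power_add)+
  show "(- 1) ^ snd k *\<^sub>R spectrum \<eta> a k $$ (r, c) = spectrum \<eta> a k $$ (swap2 r, c)"
    "(- 1) ^ fst k *\<^sub>R spectrum \<eta> a k $$ (r, c) = spectrum \<eta> a k $$ (swap4 r, c)"
    "spectrum \<eta> a k $$ (swap1 r, swap1 c) = spectrum \<eta> a k $$ (r, c)"
    by (simp_all add: spectrum_index k r c swap_less_8 par swap1_div sign)
qed

lemma Fourier_spectrum_index:
  "j \<in> Qgrid \<eta> \<Longrightarrow> r < 8 \<Longrightarrow> c < 8 \<Longrightarrow>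
    Fourier \<eta> (spectrum \<eta> a) j $$ (r, c) = dft \<eta> (row_sign r) (\<lambda>k. spectrum \<eta> a k $$ (r, c)) j"
  by (simp add: Fourier_index)

lemma Fourier_spectrum_in_H_module:
  assumes eta: "\<eta> > 0" "even \<eta>"
  shows "Fourier \<eta> (spectrum \<eta> a) \<in> H_module \<eta>"
  unfolding H_module_iff
proof (intro conjI ballI allI impI Fourier_carrier)
  fix j and r c :: nat assume *: "j \<in> Qgrid \<eta>" "r < 8" "c < 8"
  show "graded_part (r + c) (Fourier \<eta> (spectrum \<eta> a) j $$ (r, c)) = Fourier \<eta> (spectrum \<eta> a) j $$ (r, c)"
    using * by (simp add: Fourier_spectrum_index graded_part_dft)
      (rule dft_cong, simp add: spectrum_index graded_part_simps graded_part_idem)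
  show "Fourier \<eta> (spectrum \<eta> a) (shift1 \<eta> j) $$ (r, c) = Fourier \<eta> (spectrum \<eta> a) j $$ (swap2 r, c)"
    "Fourier \<eta> (spectrum \<eta> a) (shift2 \<eta> j) $$ (r, c) = Fourier \<eta> (spectrum \<eta> a) j $$ (swap4 r, c)"
    "Fourier \<eta> (spectrum \<eta> a) (reflect \<eta> j) $$ (r, c) = Fourier \<eta> (spectrum \<eta> a) j $$ (swap1 r, swap1 c)"
    using * eta
    by (simp_all add: Fourier_spectrum_index red_in_Qgrid swap_less_8 dft_symmetries row_sign_swap)
       (rule dft_cong, simp add: spectrum_symmetries)+
qed

text \<open>The half-period relations with \<open>\<sigma>\<^sub>1\<close> and \<open>\<sigma>\<^sub>2\<close> turn into the signs between block rows, the
  relation with \<open>\<tau>\<close> into the coincidence of an entry with the diagonally opposite entry of its block.\<close>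

lemma Fourier_inv_H_module:
  assumes eta: "\<eta> > 0" "even \<eta>" and U: "U \<in> H_module \<eta>"
  shows "Fourier_inv \<eta> U = spectrum \<eta> (first_row (Fourier_inv \<eta> U))"
proof -
  let ?A = "Fourier_inv \<eta> U"
  have car: "U \<in> Qgrid \<eta> \<rightarrow>\<^sub>E carrier_mat 8 8"
    and graded: "\<And>j r c. j \<in> Qgrid \<eta> \<Longrightarrow> r < 8 \<Longrightarrow> c < 8 \<Longrightarrow> graded_part (r + c) (U j $$ (r, c)) = U j $$ (r, c)"
    and sym: "\<And>j r c. j \<in> Qgrid \<eta> \<Longrightarrow> r < 8 \<Longrightarrow> c < 8 \<Longrightarrow>
        U (shift1 \<eta> j) $$ (r, c) = U j $$ (swap2 r, c)"
      "\<And>j r c. j \<in> Qgrid \<eta> \<Longrightarrow> r < 8 \<Longrightarrow> c < 8 \<Longrightarrow>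
        U (shift2 \<eta> j) $$ (r, c) = U j $$ (swap4 r, c)"
      "\<And>j r c. j \<in> Qgrid \<eta> \<Longrightarrow> r < 8 \<Longrightarrow> c < 8 \<Longrightarrow>
        U (reflect \<eta> j) $$ (r, c) = U j $$ (swap1 r, swap1 c)"
    using U unfolding H_module_iff by blast+
  have car_at: "U j \<in> carrier_mat 8 8" if "j \<in> Qgrid \<eta>" for j
    using car that by blast
  have A: "?A k $$ (r, c) = (1 / (real \<eta>)\<^sup>2) *\<^sub>R dft \<eta> (row_sign r) (\<lambda>j. U j $$ (r, c)) k"
    if "k \<in> Qgrid \<eta>" "r < 8" "c < 8" for k r c
    using that car_at by (rule Fourier_inv_index[rotated])
  have gradedA: "graded_part (r + c) (?A k $$ (r, c)) = ?A k $$ (r, c)"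
    if "k \<in> Qgrid \<eta>" "r < 8" "c < 8" for k r c
  proof -
    have "dft \<eta> (row_sign r) (\<lambda>j. graded_part (r + c) (U j $$ (r, c))) k = dft \<eta> (row_sign r) (\<lambda>j. U j $$ (r, c)) k"
      by (intro dft_cong graded that)
    then show ?thesis
      using that by (simp add: A graded_part_simps graded_part_dft)
  qed
  have A1: "?A k $$ (swap2 r, c) = (- 1) ^ snd k *\<^sub>R ?A k $$ (r, c)"
    if "k \<in> Qgrid \<eta>" "r < 8" "c < 8" for k r c
  proof -
    have "dft \<eta> (row_sign r) (\<lambda>j. U j $$ (swap2 r, c)) k = dft \<eta> (row_sign r) (\<lambda>j. U (shift1 \<eta> j) $$ (r, c)) k"
      using that by (intro dft_cong) (simp add: sym)
    also have "\<dots> = (- 1) ^ snd k *\<^sub>R dft \<eta> (row_sign r) (\<lambda>j. U j $$ (r, c)) k"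
      by (rule dft_of_symmetric(1)[OF eta]) simp
    finally show ?thesis
      using that by (simp add: A swap_less_8 row_sign_swap mult.commute)
  qed
  have A2: "?A k $$ (swap4 r, c) = (- 1) ^ fst k *\<^sub>R ?A k $$ (r, c)"
    if "k \<in> Qgrid \<eta>" "r < 8" "c < 8" for k r c
  proof -
    have "dft \<eta> (row_sign r) (\<lambda>j. U j $$ (swap4 r, c)) k = dft \<eta> (row_sign r) (\<lambda>j. U (shift2 \<eta> j) $$ (r, c)) k"
      using that by (intro dft_cong) (simp add: sym)
    also have "\<dots> = (- 1) ^ fst k *\<^sub>R dft \<eta> (row_sign r) (\<lambda>j. U j $$ (r, c)) k"
      by (rule dft_of_symmetric(2)[OF eta]) simp
    finally show ?thesis
      using that by (simp add: A swap_less_8 row_sign_swap mult.commute)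
  qed
  have A0: "?A k $$ (swap1 r, swap1 c) = ?A k $$ (r, c)"
    if "k \<in> Qgrid \<eta>" "r < 8" "c < 8" for k r c
  proof -
    have "dft \<eta> (- row_sign r) (\<lambda>j. U j $$ (swap1 r, swap1 c)) k = dft \<eta> (- row_sign r) (\<lambda>j. U (reflect \<eta> j) $$ (r, c)) k"
      using that by (intro dft_cong) (simp add: sym)
    also have "\<dots> = dft \<eta> (row_sign r) (\<lambda>j. U j $$ (r, c)) k"
      using dft_of_symmetric(3)[OF eta, of "- row_sign r"] by simp
    finally show ?thesis
      using that by (simp add: A swap_less_8 row_sign_swap)
  qed
  show ?thesis
  proof (rule spectrumI[OF Fourier_inv_carrier])
    fix k and q :: nat assume kq: "k \<in> Qgrid \<eta>" "q < 4"
    show "graded_part 0 (?A k $$ (0, 2 * q)) = ?A k $$ (0, 2 * q)"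
      "graded_part 1 (?A k $$ (0, 2 * q + 1)) = ?A k $$ (0, 2 * q + 1)"
      using gradedA[of k 0 "2 * q"] gradedA[of k 0 "2 * q + 1"] kq
        graded_part_parity[of "2 * q" 0] graded_part_parity[of "2 * q + 1" 1] by auto
    show "?A k $$ (1, 2 * q) = ?A k $$ (0, 2 * q + 1) \<and> ?A k $$ (1, 2 * q + 1) = ?A k $$ (0, 2 * q)"
      using A0[of k 0 "2 * q"] A0[of k 0 "2 * q + 1"] kq by (auto simp: swap1_def)
  next
    fix k and r c :: nat assume "k \<in> Qgrid \<eta>" "r < 2" "c < 8"
    then show "?A k $$ (2 + r, c) = (- 1) ^ snd k *\<^sub>R ?A k $$ (r, c)"
      using A1[of k r c] by (simp add: swap2_def)
  next
    fix k and r c :: nat assume "k \<in> Qgrid \<eta>" "r < 4" "c < 8"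
    then show "?A k $$ (4 + r, c) = (- 1) ^ fst k *\<^sub>R ?A k $$ (r, c)"
      using A2[of k r c] by (simp add: swap4_def add.commute)
  qed
qed


lemma sum_even_odd: "(\<Sum>c<2 * n. f c) = (\<Sum>q<n. f (2 * q) + f (2 * q + 1))"
  for f :: "nat \<Rightarrow> 'a::comm_monoid_add"
  by (induction n) (simp_all add: add.assoc)

text \<open>By Parseval's identity the norm can be read off from the coefficients. Each of the eight rows
  contributes the same amount, since signs drop out and the spinor and vector parts of \<open>a k q\<close> are
  orthogonal.\<close>

lemma ens_inner_Fourier_spectrum:
  assumes "\<eta> > 0"
  shows "ens_inner \<eta> (Fourier \<eta> (spectrum \<eta> a)) (Fourier \<eta> (spectrum \<eta> b)) =
    8 * (real \<eta>)\<^sup>2 * (\<Sum>k\<in>Qgrid \<eta>. \<Sum>q<4. inner (a k q) (b k q))"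
proof -
  have row: "(\<Sum>c<8. inner (spectrum \<eta> a k $$ (r, c)) (spectrum \<eta> b k $$ (r, c))) = (\<Sum>q<4. inner (a k q) (b k q))"
    if k: "k \<in> Qgrid \<eta>" and r: "r < 8" for k r
  proof -
    have "inner (spectrum \<eta> a k $$ (r, 2 * q)) (spectrum \<eta> b k $$ (r, 2 * q)) +
        inner (spectrum \<eta> a k $$ (r, 2 * q + 1)) (spectrum \<eta> b k $$ (r, 2 * q + 1)) = inner (a k q) (b k q)"
      if "q < 4" for q
      using that k r inner_graded_parts[of "r + 2 * q" "a k q" "b k q"]
      by (simp add: spectrum_index mult.assoc[symmetric] block_sign_square)
    then show ?thesis
      using sum_even_odd[of "\<lambda>c. inner (spectrum \<eta> a k $$ (r, c)) (spectrum \<eta> b k $$ (r, c))" 4] by simp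
  qed
  have "ens_inner \<eta> (Fourier \<eta> (spectrum \<eta> a)) (Fourier \<eta> (spectrum \<eta> b)) =
      (\<Sum>r<8. \<Sum>c<8. \<Sum>j\<in>Qgrid \<eta>. inner (Fourier \<eta> (spectrum \<eta> a) j $$ (r, c)) (Fourier \<eta> (spectrum \<eta> b) j $$ (r, c)))"
    unfolding ens_inner_def
    by (subst sum.swap, rule sum.cong[OF refl], rule sum.swap)
  also have "\<dots> = (\<Sum>r<8. \<Sum>c<8. (real \<eta>)\<^sup>2 * (\<Sum>k\<in>Qgrid \<eta>. inner (spectrum \<eta> a k $$ (r, c)) (spectrum \<eta> b k $$ (r, c))))"
    by (intro sum.cong refl) (simp add: Fourier_spectrum_index dft_parseval assms)
  also have "\<dots> = (real \<eta>)\<^sup>2 * (\<Sum>r<8. \<Sum>k\<in>Qgrid \<eta>. \<Sum>c<8. inner (spectrum \<eta> a k $$ (r, c)) (spectrum \<eta> b k $$ (r, c)))"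
    unfolding sum_distrib_left[symmetric] by (subst sum.swap[where B = "Qgrid \<eta>"]) (rule refl)
  also have "\<dots> = (real \<eta>)\<^sup>2 * (\<Sum>r<8::nat. \<Sum>k\<in>Qgrid \<eta>. \<Sum>q<4. inner (a k q) (b k q))"
    by (simp add: row)
  finally show ?thesis by simp
qed

lemma ens_diff_Fourier_spectrum:
  assumes "\<eta> > 0"
  shows "ens_diff \<eta> (Fourier \<eta> (spectrum \<eta> a)) (Fourier \<eta> (spectrum \<eta> b)) =
    Fourier \<eta> (spectrum \<eta> (\<lambda>k q. a k q - b k q))"
proof (rule ensemble_eqI[OF _ Fourier_carrier])
  have car: "Fourier \<eta> (spectrum \<eta> a) k \<in> carrier_mat 8 8" if "k \<in> Qgrid \<eta>" for a k
    using Fourier_carrier[of \<eta> "spectrum \<eta> a"] that by blast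
  then show "ens_diff \<eta> (Fourier \<eta> (spectrum \<eta> a)) (Fourier \<eta> (spectrum \<eta> b)) \<in> Qgrid \<eta> \<rightarrow>\<^sub>E carrier_mat 8 8"
    unfolding ens_diff_def by (intro restrict_PiE_iff[THEN iffD2] ballI minus_carrier_mat)
  fix j and r c :: nat assume *: "j \<in> Qgrid \<eta>" "r < 8" "c < 8"
  have "ens_diff \<eta> (Fourier \<eta> (spectrum \<eta> a)) (Fourier \<eta> (spectrum \<eta> b)) j $$ (r, c) =
      dft \<eta> (row_sign r) (\<lambda>k. spectrum \<eta> a k $$ (r, c) - spectrum \<eta> b k $$ (r, c)) j"
    using * car[OF *(1), of a] car[OF *(1), of b] by (simp add: ens_diff_def dft_diff Fourier_spectrum_index)
  also have "\<dots> = Fourier \<eta> (spectrum \<eta> (\<lambda>k q. a k q - b k q)) j $$ (r, c)"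
    unfolding Fourier_spectrum_index[OF *]
    by (rule dft_cong) (simp add: spectrum_index * graded_part_simps scaleR_diff_right)
  finally show "ens_diff \<eta> (Fourier \<eta> (spectrum \<eta> a)) (Fourier \<eta> (spectrum \<eta> b)) j $$ (r, c) =
      Fourier \<eta> (spectrum \<eta> (\<lambda>k q. a k q - b k q)) j $$ (r, c)" .
qed

lemma spectrum_cong:
  assumes "\<And>k q. k \<in> Qgrid \<eta> \<Longrightarrow> q < 4 \<Longrightarrow> a k q = b k q"
  shows "spectrum \<eta> a = spectrum \<eta> b"
  by (rule ensemble_eqI[OF spectrum_carrier spectrum_carrier]) (simp add: spectrum_index assms)

section \<open>Moment constraints\<close>

lemma S_diag13_iff:
  assumes M: "M \<in> S_mat 4"
  shows "M \<in> S_diag13 \<longleftrightarrow> (\<forall>r<8. \<forall>c<8. r < 2 \<and> 2 \<le> c \<or> 2 \<le> r \<and> c < 2 \<longrightarrow> M $$ (r, c) = 0)"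
proof
  assume "M \<in> S_diag13"
  then obtain X D where X: "X \<in> carrier_mat 2 2" and D: "D \<in> carrier_mat 6 6" and MXD: "M = diag_block_mat [X, D]"
    by (auto simp: S_diag13_def S_alg_def S_mat_def)
  then show "\<forall>r<8. \<forall>c<8. r < 2 \<and> 2 \<le> c \<or> 2 \<le> r \<and> c < 2 \<longrightarrow> M $$ (r, c) = 0"
    by (auto simp: Let_def)
next
  assume zero: "\<forall>r<8. \<forall>c<8. r < 2 \<and> 2 \<le> c \<or> 2 \<le> r \<and> c < 2 \<longrightarrow> M $$ (r, c) = 0"
  define X where "X = mat 2 2 (\<lambda>(r, c). M $$ (r, c))"
  define D where "D = mat 6 6 (\<lambda>(r, c). M $$ (2 + r, 2 + c))"
  have car: "M \<in> carrier_mat 8 8" and graded: "\<And>r c. r < 8 \<Longrightarrow> c < 8 \<Longrightarrow> graded_part (r + c) (M $$ (r, c)) = M $$ (r, c)"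
    using M by (auto simp: S_mat_iff)
  have "graded_part (2 + r + (2 + c)) = graded_part (r + c)" for r c
    by (rule graded_part_parity) simp
  then have "D \<in> S_mat 3"
    using graded[of "2 + _" "2 + _"] by (simp add: S_mat_iff D_def)
  moreover have "X \<in> S_alg"
    using graded[of 0 0] graded[of 0 1] graded[of 1 0] graded[of 1 1] graded_part_parity[of 2 0]
    by (simp add: S_alg_def X_def spinors_iff vectors_iff numeral_2_eq_2)
  moreover have "M = diag_block_mat [X, D]"
  proof (rule eq_matI)
    fix i j assume "i < dim_row (diag_block_mat [X, D])" "j < dim_col (diag_block_mat [X, D])"
    then have "i < 8" "j < 8"
      by (simp_all add: X_def D_def Let_def)
    moreover from this have "i < 2 \<or> i = Suc (Suc (i - 2))" "j < 2 \<or> j = Suc (Suc (j - 2))"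
      by auto
    ultimately show "M $$ (i, j) = diag_block_mat [X, D] $$ (i, j)"
      using zero by (auto simp: X_def D_def Let_def)
  qed (use car in \<open>simp_all add: X_def D_def Let_def\<close>)
  ultimately show "M \<in> S_diag13"
    by (auto simp: S_diag13_def)
qed

definition grid_monomial :: "nat \<times> nat \<Rightarrow> nat \<times> nat \<Rightarrow> real" where
  "grid_monomial \<alpha> k = real (snd k) ^ fst \<alpha> * real (fst k) ^ snd \<alpha>"

lemma c_coeff_phase:
  "c_coeff \<eta> \<alpha> j = diag2 (\<lambda>r. \<Sum>k\<in>Qgrid \<eta>. grid_monomial \<alpha> k *\<^sub>R phase \<eta> (row_sign r * iwedge k j))"
proof -
  have "real_bracket x * diag2 d = diag2 (\<lambda>r. x *\<^sub>R d r)" for x d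
    by (intro eq_matI) (auto simp: real_bracket_def diag2_def scaleR_conv_of_real scalar_prod_def
        numeral_2_eq_2 less_Suc_eq)
  then have "c_coeff \<eta> \<alpha> j = mat_sum 2 2 (\<lambda>k. diag2 (\<lambda>r. grid_monomial \<alpha> k *\<^sub>R phase \<eta> (row_sign r * iwedge k j))) (Qgrid \<eta>)"
    by (simp only: c_coeff_def exp_bracket_phase grid_monomial_def)
  also have "\<dots> = diag2 (\<lambda>r. \<Sum>k\<in>Qgrid \<eta>. grid_monomial \<alpha> k *\<^sub>R phase \<eta> (row_sign r * iwedge k j))"
    by (intro eq_matI) (auto simp: mat_sum_def diag2_def)
  finally show ?thesis .
qed

text \<open>Interchanging the two sums applies the transform a second time, and this restores the
  coefficients up to the factor \<open>\<eta>\<^sup>2\<close>.\<close>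

lemma moment_of_Fourier:
  assumes eta: "\<eta> > 0" and B: "\<And>k. k \<in> Qgrid \<eta> \<Longrightarrow> B k \<in> carrier_mat 8 8" and rc: "r < 8" "c < 8"
  shows "mat_sum 8 8 (\<lambda>j. c_coeff \<eta> \<alpha> j \<circledast> Fourier \<eta> B j) (Qgrid \<eta>) $$ (r, c) =
    (real \<eta>)\<^sup>2 *\<^sub>R (\<Sum>k\<in>Qgrid \<eta>. grid_monomial \<alpha> k *\<^sub>R B k $$ (r, c))"
proof -
  let ?s = "row_sign r"
  have car: "Fourier \<eta> B k \<in> carrier_mat 8 8" if "k \<in> Qgrid \<eta>" for k
    using Fourier_carrier[of \<eta> B] that by blast
  have "mat_sum 8 8 (\<lambda>j. c_coeff \<eta> \<alpha> j \<circledast> Fourier \<eta> B j) (Qgrid \<eta>) $$ (r, c) =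
      (\<Sum>j\<in>Qgrid \<eta>. \<Sum>k\<in>Qgrid \<eta>. grid_monomial \<alpha> k *\<^sub>R (phase \<eta> (?s * iwedge k j) * dft \<eta> ?s (\<lambda>k. B k $$ (r, c)) j))"
    using rc block_act_diag2[of _ 4 4 r c] car
    by (simp add: mat_sum_def c_coeff_phase Fourier_index B sum_distrib_right)
  also have "\<dots> = (\<Sum>k\<in>Qgrid \<eta>. grid_monomial \<alpha> k *\<^sub>R dft \<eta> ?s (dft \<eta> ?s (\<lambda>k. B k $$ (r, c))) k)"
    by (subst sum.swap) (simp add: dft_def[of _ _ "dft _ _ _"] scaleR_sum_right)
  also have "\<dots> = (\<Sum>k\<in>Qgrid \<eta>. grid_monomial \<alpha> k *\<^sub>R ((real \<eta>)\<^sup>2 *\<^sub>R B k $$ (r, c)))"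
    by (intro sum.cong refl) (simp add: dft_dft eta)
  finally show ?thesis
    by (simp add: scaleR_sum_right mult.commute)
qed

lemma graded_parts_zero_iff: "graded_part d x = 0 \<and> graded_part (Suc d) x = 0 \<longleftrightarrow> x = 0"
  using graded_part_add_Suc[of d x] by (auto simp: graded_part_simps)

text \<open>The off-diagonal blocks in the first block row give the conditions for \<open>q \<ge> 1\<close>; those in the
  first block column all involve \<open>b k 0\<close>, weighted by the signs of the block rows \<open>p \<ge> 1\<close>.\<close>

definition vanishing_moments :: "nat \<Rightarrow> nat \<Rightarrow> (nat \<times> nat \<Rightarrow> nat \<Rightarrow> quat) \<Rightarrow> bool" where
  "vanishing_moments \<eta> \<mu> b \<longleftrightarrow> (\<forall>\<alpha>\<in>multi_idx \<mu>.
     (\<forall>q\<in>{1..3}. (\<Sum>k\<in>Qgrid \<eta>. grid_monomial \<alpha> k *\<^sub>R b k q) = 0) \<and>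
     (\<forall>p\<in>{1..3}. (\<Sum>k\<in>Qgrid \<eta>. (block_sign k p * grid_monomial \<alpha> k) *\<^sub>R b k 0) = 0))"

text \<open>Every block of the moment matrix consists of the spinor and vector parts of one weighted sum,
  so it vanishes together with that sum; the top left block and the nine blocks of the lower right
  part are unrestricted.\<close>

lemma Fourier_spectrum_in_C2_iff:
  assumes eta: "\<eta> > 0" "even \<eta>"
  shows "Fourier \<eta> (spectrum \<eta> b) \<in> C2 \<eta> \<mu> \<longleftrightarrow> vanishing_moments \<eta> \<mu> b"
proof -
  define m where "m \<alpha> p q = (\<Sum>k\<in>Qgrid \<eta>. (block_sign k p * grid_monomial \<alpha> k) *\<^sub>R b k q)" for \<alpha> p q
  have "mat_sum 8 8 (\<lambda>j. c_coeff \<eta> \<alpha> j \<circledast> Fourier \<eta> (spectrum \<eta> b) j) (Qgrid \<eta>) \<in> S_diag13 \<longleftrightarrow>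
      (\<forall>q\<in>{1..3}. m \<alpha> 0 q = 0) \<and> (\<forall>p\<in>{1..3}. m \<alpha> p 0 = 0)" for \<alpha>
  proof -
    define M where "M = mat_sum 8 8 (\<lambda>j. c_coeff \<eta> \<alpha> j \<circledast> Fourier \<eta> (spectrum \<eta> b) j) (Qgrid \<eta>)"
    have M: "M $$ (r, c) = (real \<eta>)\<^sup>2 *\<^sub>R graded_part (r + c) (m \<alpha> (r div 2) (c div 2))" if "r < 8" "c < 8" for r c
      unfolding M_def m_def
      by (subst moment_of_Fourier)
        (use that eta in \<open>auto simp: graded_part_sum graded_part_simps spectrum_index mult.commute intro!: sum.cong\<close>)
    have "M \<in> S_mat 4"
      by (simp add: S_mat_iff M graded_part_simps graded_part_idem) (simp add: M_def mat_sum_def)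
    have zero: "(\<forall>d<2. \<forall>e<2. M $$ (2 * p + d, 2 * q + e) = 0) \<longleftrightarrow> m \<alpha> p q = 0" if "p < 4" "q < 4" for p q
    proof -
      have entry: "M $$ (2 * p + d, 2 * q + e) = (real \<eta>)\<^sup>2 *\<^sub>R graded_part (d + e) (m \<alpha> p q)"
        if "d < 2" "e < 2" for d e
      proof -
        have "graded_part (2 * p + d + (2 * q + e)) = graded_part (d + e)"
          by (rule graded_part_parity) simp
        then show ?thesis
          using M[of "2 * p + d" "2 * q + e"] that \<open>p < 4\<close> \<open>q < 4\<close> by simp
      qed
      show ?thesis
      proof
        assume H: "\<forall>d<2. \<forall>e<2. M $$ (2 * p + d, 2 * q + e) = 0"
        have "graded_part 0 (m \<alpha> p q) = 0" "graded_part 1 (m \<alpha> p q) = 0"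
          using H[rule_format, of 0 0] H[rule_format, of 0 1] entry[of 0 0] entry[of 0 1] eta(1) by simp_all
        then show "m \<alpha> p q = 0"
          using graded_parts_zero_iff[of 0 "m \<alpha> p q"] by simp
      qed (simp add: entry graded_part_simps)
    qed
    have "(\<forall>r<8. \<forall>c<8. r < 2 \<and> 2 \<le> c \<or> 2 \<le> r \<and> c < 2 \<longrightarrow> M $$ (r, c) = 0) \<longleftrightarrow>
        (\<forall>p<4. \<forall>q<4. p = 0 \<and> q \<noteq> 0 \<or> p \<noteq> 0 \<and> q = 0 \<longrightarrow> (\<forall>d<2. \<forall>e<2. M $$ (2 * p + d, 2 * q + e) = 0))"
      (is "?L \<longleftrightarrow> ?R")
    proof
      assume ?L
      then show ?R by auto
    next
      assume R: ?R
      show ?L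
      proof (intro allI impI)
        fix r c :: nat assume "r < 8" "c < 8" "r < 2 \<and> 2 \<le> c \<or> 2 \<le> r \<and> c < 2"
        then have "\<forall>d<2. \<forall>e<2. M $$ (2 * (r div 2) + d, 2 * (c div 2) + e) = 0"
          using R[rule_format, of "r div 2" "c div 2"] by auto
        then have "M $$ (2 * (r div 2) + r mod 2, 2 * (c div 2) + c mod 2) = 0"
          by (meson mod_less_divisor pos2)
        then show "M $$ (r, c) = 0" by simp
      qed
    qed
    also have "\<dots> \<longleftrightarrow> (\<forall>q\<in>{1..3}. m \<alpha> 0 q = 0) \<and> (\<forall>p\<in>{1..3}. m \<alpha> p 0 = 0)"
    proof -
      have range: "n \<in> {1..3} \<longleftrightarrow> n < 4 \<and> n \<noteq> 0" for n :: nat by auto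
      have "(0::nat) < 4" by simp
      then show ?thesis using zero range by metis
    qed
    finally show ?thesis
      using S_diag13_iff[OF \<open>M \<in> S_mat 4\<close>] by (simp add: M_def)
  qed
  then show ?thesis
    by (auto simp: C2_def Fourier_spectrum_in_H_module eta vanishing_moments_def m_def)
qed

section \<open>Orthogonal projection onto a real null space\<close>

text \<open>The equation \<open>1 - P = M\<^sup>T G\<close> says that \<open>P\<close> changes a vector only within the row space, which is
  the orthogonal complement of the null space.\<close>

lemma null_space_projection:
  fixes M :: "real mat"
  assumes M: "M \<in> carrier_mat m N" and inv: "invertible_mat (M * transpose_mat M)"
    and P: "P = 1\<^sub>m N - transpose_mat M * the (mat_inverse (M * transpose_mat M)) * M"
  shows "P \<in> carrier_mat N N" "M * P = 0\<^sub>m m N"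
    and "\<exists>G \<in> carrier_mat m N. 1\<^sub>m N - P = transpose_mat M * G"
proof -
  let ?Q = "M * transpose_mat M"
  have Q: "?Q \<in> carrier_mat m m" using M by simp
  from inv obtain B where B: "?Q * B = 1\<^sub>m m" "B * ?Q = 1\<^sub>m (dim_row B)"
    using M by (auto simp: invertible_mat_def inverts_mat_def)
  then have BB: "B \<in> carrier_mat m m"
    using M by (metis Q carrier_matD(2) carrier_matI index_mult_mat(2,3) index_one_mat(2,3) mult.commute)
  have "?Q \<in> Units (ring_mat TYPE(real) m ())"
    using B BB Q by (auto simp: Units_def ring_mat_simps intro!: bexI[of _ B])
  then obtain V where V: "mat_inverse ?Q = Some V"
    using mat_inverse(1)[OF Q, of "()"] by (cases "mat_inverse ?Q") auto
  have QV: "?Q * V = 1\<^sub>m m" and VC: "V \<in> carrier_mat m m"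
    using mat_inverse(2)[OF Q V] by auto
  have G: "transpose_mat M * V * M = transpose_mat M * (V * M)"
    using M VC by simp
  show "P \<in> carrier_mat N N"
    unfolding P V option.sel G using M VC
    by (intro minus_carrier_mat mult_carrier_mat[of _ N m] mult_carrier_mat[of _ m m]) auto
  have "M * (transpose_mat M * (V * M)) = ?Q * V * M"
    using M VC by (simp add: assoc_mult_mat[of _ m N _ m _ N] assoc_mult_mat[of _ m m _ m _ N])
  also have "\<dots> = M" using M by (simp add: QV)
  finally have "M * (transpose_mat M * (V * M)) = M" .
  then show "M * P = 0\<^sub>m m N"
    unfolding P V option.sel G using M VC
    by (subst mult_minus_distrib_mat[of _ m N _ N]) auto
  have "1\<^sub>m N - P = transpose_mat M * (V * M)"
    unfolding P V option.sel G using M VC by (intro eq_matI) auto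
  then show "\<exists>G \<in> carrier_mat m N. 1\<^sub>m N - P = transpose_mat M * G"
    using M VC by (intro bexI[of _ "V * M"]) auto
qed

lemma real_mat_act_index:
  assumes "P \<in> carrier_mat m N" "x \<in> carrier_vec N" "i < m"
  shows "real_mat_act P x $ i = (\<Sum>n<N. P $$ (i, n) *\<^sub>R x $ n)"
  using assms by (simp add: real_mat_act_def scalar_prod_def scaleR_conv_of_real lessThan_atLeast0)

text \<open>Quaternionic entries cause no difficulty because the matrix is real: \<open>x - y = M\<^sup>T w\<close> for a
  quaternionic \<open>w\<close>, and \<open>M\<^sup>T\<close> is still the adjoint of \<open>M\<close>, so pairing with \<open>z\<close> gives
  \<open>\<langle>w, M z\<rangle> = 0\<close>.\<close>

lemma real_mat_act_projection:
  fixes M :: "real mat" and x :: "quat vec"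
  assumes M: "M \<in> carrier_mat m N" and inv: "invertible_mat (M * transpose_mat M)"
    and P: "P = 1\<^sub>m N - transpose_mat M * the (mat_inverse (M * transpose_mat M)) * M"
    and x: "x \<in> carrier_vec N"
  defines "y \<equiv> real_mat_act P x"
  shows "\<And>i. i < m \<Longrightarrow> (\<Sum>n<N. M $$ (i, n) *\<^sub>R y $ n) = 0"
    and "\<And>z :: nat \<Rightarrow> quat. (\<And>i. i < m \<Longrightarrow> (\<Sum>n<N. M $$ (i, n) *\<^sub>R z n) = 0) \<Longrightarrow>
      (\<Sum>n<N. inner (x $ n - y $ n) (z n)) = 0"
proof -
  note null = null_space_projection[OF M inv P]
  from null(3) obtain G where G: "G \<in> carrier_mat m N" and PG: "1\<^sub>m N - P = transpose_mat M * G"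
    by blast
  have y: "y $ n = (\<Sum>l<N. P $$ (n, l) *\<^sub>R x $ l)" if "n < N" for n
    unfolding y_def by (rule real_mat_act_index[OF null(1) x that])
  show "(\<Sum>n<N. M $$ (i, n) *\<^sub>R y $ n) = 0" if i: "i < m" for i
  proof -
    have MP: "(\<Sum>n<N. M $$ (i, n) * P $$ (n, l)) = 0" if "l < N" for l
    proof -
      have "(M * P) $$ (i, l) = 0" using null(2) i that by simp
      then show ?thesis using M null(1) i that by (simp add: scalar_prod_def lessThan_atLeast0)
    qed
    have "(\<Sum>n<N. M $$ (i, n) *\<^sub>R y $ n) = (\<Sum>n<N. \<Sum>l<N. (M $$ (i, n) * P $$ (n, l)) *\<^sub>R x $ l)"
      by (simp add: y scaleR_sum_right)
    also have "\<dots> = (\<Sum>l<N. (\<Sum>n<N. M $$ (i, n) * P $$ (n, l)) *\<^sub>R x $ l)"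
      unfolding scaleR_sum_left by (rule sum.swap)
    finally show ?thesis by (simp add: MP)
  qed
  fix z :: "nat \<Rightarrow> quat" assume z: "\<And>i. i < m \<Longrightarrow> (\<Sum>n<N. M $$ (i, n) *\<^sub>R z n) = 0"
  \<comment> \<open>The multipliers that express \<open>x - y\<close> through the rows of \<open>M\<close>.\<close>
  define w where "w i = (\<Sum>l<N. G $$ (i, l) *\<^sub>R x $ l)" for i
  have "x $ n - y $ n = (\<Sum>i<m. M $$ (i, n) *\<^sub>R w i)" if n: "n < N" for n
  proof -
    have entry: "(if n = l then 1 else 0) - P $$ (n, l) = (\<Sum>i<m. M $$ (i, n) * G $$ (i, l))" if "l < N" for l
    proof -
      have "(1\<^sub>m N - P) $$ (n, l) = (transpose_mat M * G) $$ (n, l)" by (simp add: PG)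
      then show ?thesis using M G null(1) n that by (simp add: scalar_prod_def lessThan_atLeast0)
    qed
    have "x $ n = (\<Sum>l<N. (if n = l then 1 else 0) *\<^sub>R x $ l)"
      using n by (simp add: if_distrib[of "\<lambda>t. t *\<^sub>R _"] cong: if_cong)
    then have "x $ n - y $ n = (\<Sum>l<N. ((if n = l then 1 else 0) - P $$ (n, l)) *\<^sub>R x $ l)"
      by (simp add: y[OF n] scaleR_diff_left sum_subtractf)
    also have "\<dots> = (\<Sum>l<N. \<Sum>i<m. (M $$ (i, n) * G $$ (i, l)) *\<^sub>R x $ l)"
      by (intro sum.cong refl) (simp add: entry scaleR_sum_left)
    also have "\<dots> = (\<Sum>i<m. M $$ (i, n) *\<^sub>R w i)"
      by (subst sum.swap) (simp add: w_def scaleR_sum_right)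
    finally show ?thesis .
  qed
  then have "(\<Sum>n<N. inner (x $ n - y $ n) (z n)) = (\<Sum>n<N. \<Sum>i<m. inner (w i) (M $$ (i, n) *\<^sub>R z n))"
    by (simp add: inner_sum_left)
  also have "\<dots> = (\<Sum>i<m. inner (w i) (\<Sum>n<N. M $$ (i, n) *\<^sub>R z n))"
    by (subst sum.swap) (simp add: inner_sum_right)
  finally show "(\<Sum>n<N. inner (x $ n - y $ n) (z n)) = 0"
    by (simp add: z)
qed

section \<open>The nearest point\<close>

lemma vanishing_moments_diff:
  "vanishing_moments \<eta> \<mu> a \<Longrightarrow> vanishing_moments \<eta> \<mu> b \<Longrightarrow> vanishing_moments \<eta> \<mu> (\<lambda>k q. a k q - b k q)"
  by (simp add: vanishing_moments_def scaleR_diff_right sum_subtractf)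

text \<open>For \<open>b\<close> in the linear space of coefficients with vanishing moments, the orthogonality hypothesis
  gives \<open>\<parallel>a - b\<parallel>\<^sup>2 = \<parallel>a - p\<parallel>\<^sup>2 + \<parallel>p - b\<parallel>\<^sup>2\<close>, which is minimal exactly for \<open>b = p\<close>.\<close>

lemma proj_set_C2I:
  assumes eta: "\<eta> > 0" "even \<eta>"
    and p: "vanishing_moments \<eta> \<mu> p"
    and orth: "\<And>z. vanishing_moments \<eta> \<mu> z \<Longrightarrow>
      (\<Sum>k\<in>Qgrid \<eta>. \<Sum>q<4. inner (a k q - p k q) (z k q)) = 0"
  shows "proj_set \<eta> (C2 \<eta> \<mu>) (Fourier \<eta> (spectrum \<eta> a)) = {Fourier \<eta> (spectrum \<eta> p)}"
proof -
  define D where "D x y = (\<Sum>k\<in>Qgrid \<eta>. \<Sum>q<4. inner (x k q - y k q) (x k q - y k q))"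
    for x y :: "nat \<times> nat \<Rightarrow> nat \<Rightarrow> quat"
  have norm: "ens_norm \<eta> (ens_diff \<eta> (Fourier \<eta> (spectrum \<eta> x)) (Fourier \<eta> (spectrum \<eta> y))) =
      sqrt (8 * (real \<eta>)\<^sup>2 * D x y)" for x y
    by (simp add: ens_norm_def ens_diff_Fourier_spectrum ens_inner_Fourier_spectrum eta D_def)
  have norm_le: "ens_norm \<eta> (ens_diff \<eta> (Fourier \<eta> (spectrum \<eta> x)) (Fourier \<eta> (spectrum \<eta> y))) \<le>
      ens_norm \<eta> (ens_diff \<eta> (Fourier \<eta> (spectrum \<eta> x)) (Fourier \<eta> (spectrum \<eta> y'))) \<longleftrightarrow> D x y \<le> D x y'" for x y y'
    using eta by (simp add: norm)
  have pythagoras: "D a b = D a p + D p b" if "vanishing_moments \<eta> \<mu> b" for b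
  proof -
    have "inner (a k q - b k q) (a k q - b k q) = inner (a k q - p k q) (a k q - p k q) +
        inner (p k q - b k q) (p k q - b k q) + 2 * inner (a k q - p k q) (p k q - b k q)" for k q
      by (simp add: inner_diff_left inner_diff_right inner_commute)
    then have "D a b = D a p + D p b + 2 * (\<Sum>k\<in>Qgrid \<eta>. \<Sum>q<4. inner (a k q - p k q) (p k q - b k q))"
      by (simp add: D_def sum.distrib sum_distrib_left)
    then show ?thesis
      using orth[OF vanishing_moments_diff[OF p that]] by simp
  qed
  have D_nonneg: "D x y \<ge> 0" for x y
    by (simp add: D_def sum_nonneg)
  have param: "\<exists>b. W = Fourier \<eta> (spectrum \<eta> b) \<and> vanishing_moments \<eta> \<mu> b" if W: "W \<in> C2 \<eta> \<mu>" for W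
  proof -
    have "W \<in> H_module \<eta>" using W by (simp add: C2_def)
    then have "W = Fourier \<eta> (spectrum \<eta> (first_row (Fourier_inv \<eta> W)))"
      using Fourier_inv_H_module[OF eta, of W] Fourier_Fourier_inv[OF eta(1), of W] H_module_iff[of W \<eta>] by simp
    then show ?thesis
      using W Fourier_spectrum_in_C2_iff[OF eta] by metis
  qed
  show ?thesis
  proof (intro equalityI subsetI)
    fix V assume V: "V \<in> proj_set \<eta> (C2 \<eta> \<mu>) (Fourier \<eta> (spectrum \<eta> a))"
    then obtain b where b: "V = Fourier \<eta> (spectrum \<eta> b)" "vanishing_moments \<eta> \<mu> b"
      using param by (auto simp: proj_set_def)
    have "Fourier \<eta> (spectrum \<eta> p) \<in> C2 \<eta> \<mu>"
      using Fourier_spectrum_in_C2_iff[OF eta] p by blast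
    then have "D a b \<le> D a p"
      using V by (auto simp: proj_set_def b(1) norm_le)
    then have "D p b = 0"
      using pythagoras[OF b(2)] D_nonneg[of p b] by linarith
    then have "\<forall>k\<in>Qgrid \<eta>. (\<Sum>q<4. inner (p k q - b k q) (p k q - b k q)) = 0"
      unfolding D_def by (subst (asm) sum_nonneg_eq_0_iff) (auto intro: sum_nonneg)
    then have "p k q = b k q" if "k \<in> Qgrid \<eta>" "q < 4" for k q
      using that by (subst (asm) sum_nonneg_eq_0_iff) auto
    then have "spectrum \<eta> p = spectrum \<eta> b"
      by (rule spectrum_cong)
    then show "V \<in> {Fourier \<eta> (spectrum \<eta> p)}"
      by (simp add: b(1))
  next
    fix V assume "V \<in> {Fourier \<eta> (spectrum \<eta> p)}"
    then have V: "V = Fourier \<eta> (spectrum \<eta> p)" by simp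
    have "ens_norm \<eta> (ens_diff \<eta> (Fourier \<eta> (spectrum \<eta> a)) V) \<le> ens_norm \<eta> (ens_diff \<eta> (Fourier \<eta> (spectrum \<eta> a)) W)"
      if W: "W \<in> C2 \<eta> \<mu>" for W
    proof -
      obtain b where b: "W = Fourier \<eta> (spectrum \<eta> b)" "vanishing_moments \<eta> \<mu> b"
        using param[OF W] by blast
      then show ?thesis
        using pythagoras[OF b(2)] D_nonneg[of p b] by (simp add: V norm_le)
    qed
    then show "V \<in> proj_set \<eta> (C2 \<eta> \<mu>) (Fourier \<eta> (spectrum \<eta> a))"
      using Fourier_spectrum_in_C2_iff[OF eta] p by (simp add: proj_set_def V)
  qed
qed

lemma bij_betw_shift_index:
  assumes "bij_betw \<nu> {1..N::nat} Q"
  shows "bij_betw (\<lambda>n. \<nu> (n + 1)) {..<N} Q"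
proof -
  have "bij_betw Suc {..<N} {1..N}"
    by (simp add: bij_betw_def image_Suc_lessThan)
  from bij_betw_trans[OF this assms] show ?thesis
    by (simp add: comp_def)
qed

lemma sum_enumerated:
  "bij_betw \<nu> {1..N::nat} Q \<Longrightarrow> sum f Q = (\<Sum>n<N. f (\<nu> (n + 1)))"
  using sum.reindex_bij_betw[OF bij_betw_shift_index[of \<nu> N Q], of f] by simp

lemma append_rows_index:
  assumes "A \<in> carrier_mat m N" "B \<in> carrier_mat m' N" "n < N"
  shows "i < m \<Longrightarrow> (A @\<^sub>r B) $$ (i, n) = A $$ (i, n)"
    and "i < m' \<Longrightarrow> (A @\<^sub>r B) $$ (m + i, n) = B $$ (i, n)"
  using assms by (auto simp: append_rows_def)

text \<open>Stacking the three signed copies of \<open>R\<close> collects the conditions coming from the block rows 1, 2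
  and 3: the vector \<open>(b k 0)\<^sub>k\<close> must lie in the null space of \<open>S\<close>, and each other \<open>(b k q)\<^sub>k\<close> in that
  of \<open>R\<close>.\<close>

lemma vanishing_moments_null_space:
  fixes R S1 S2 S3 S :: "real mat"
  assumes nu: "bij_betw \<nu> {1..\<eta>\<^sup>2} (Qgrid \<eta>)"
    and rho: "bij_betw \<rho> {1..m} (multi_idx \<mu>)"
    and R: "R = mat m (\<eta>\<^sup>2) (\<lambda>(i, n). grid_monomial (\<rho> (i + 1)) (\<nu> (n + 1)))"
    and S1: "S1 = mat m (\<eta>\<^sup>2) (\<lambda>(i, n). (-1) ^ snd (\<nu> (n + 1)) * R $$ (i, n))"
    and S2: "S2 = mat m (\<eta>\<^sup>2) (\<lambda>(i, n). (-1) ^ fst (\<nu> (n + 1)) * R $$ (i, n))"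
    and S3: "S3 = mat m (\<eta>\<^sup>2) (\<lambda>(i, n). (-1) ^ (fst (\<nu> (n + 1)) + snd (\<nu> (n + 1))) * R $$ (i, n))"
    and S: "S = S1 @\<^sub>r S2 @\<^sub>r S3"
  shows "vanishing_moments \<eta> \<mu> b \<longleftrightarrow>
    (\<forall>q\<in>{1..3}. \<forall>i<m. (\<Sum>n<\<eta>\<^sup>2. R $$ (i, n) *\<^sub>R b (\<nu> (n + 1)) q) = 0) \<and>
    (\<forall>i<m + (m + m). (\<Sum>n<\<eta>\<^sup>2. S $$ (i, n) *\<^sub>R b (\<nu> (n + 1)) 0) = 0)"
proof -
  have car: "S1 \<in> carrier_mat m (\<eta>\<^sup>2)" "S2 \<in> carrier_mat m (\<eta>\<^sup>2)" "S3 \<in> carrier_mat m (\<eta>\<^sup>2)"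
    "S2 @\<^sub>r S3 \<in> carrier_mat (m + m) (\<eta>\<^sup>2)"
    by (auto simp: S1 S2 S3)
  define mom where "mom i p q = (\<Sum>n<\<eta>\<^sup>2. (block_sign (\<nu> (n + 1)) p * grid_monomial (\<rho> (i + 1)) (\<nu> (n + 1))) *\<^sub>R b (\<nu> (n + 1)) q)" for i p q
  note grid_sum = sum_enumerated[OF nu]
  have "multi_idx \<mu> = (\<lambda>i. \<rho> (i + 1)) ` {..<m}"
    using bij_betw_imp_surj_on[OF bij_betw_shift_index[OF rho]] by simp
  then have vm: "vanishing_moments \<eta> \<mu> b \<longleftrightarrow>
      (\<forall>i<m. (\<forall>q\<in>{1..3}. mom i 0 q = 0) \<and> (\<forall>p\<in>{1..3}. mom i p 0 = 0))"
    by (auto simp: vanishing_moments_def grid_sum mom_def)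
  have R_mom: "(\<Sum>n<\<eta>\<^sup>2. R $$ (i, n) *\<^sub>R b (\<nu> (n + 1)) q) = mom i 0 q" if "i < m" for i q
    using that by (simp add: mom_def R)
  have S_mom: "(\<Sum>n<\<eta>\<^sup>2. S $$ (i, n) *\<^sub>R b (\<nu> (n + 1)) 0) = mom i 1 0"
    "(\<Sum>n<\<eta>\<^sup>2. S $$ (m + i, n) *\<^sub>R b (\<nu> (n + 1)) 0) = mom i 2 0"
    "(\<Sum>n<\<eta>\<^sup>2. S $$ (m + (m + i), n) *\<^sub>R b (\<nu> (n + 1)) 0) = mom i 3 0" if "i < m" for i
    using that
    by (simp_all add: mom_def S append_rows_index[OF car(1,4)] append_rows_index[OF car(2,3)])
      (simp_all add: S1 S2 S3 R)
  have split: "(\<forall>i<m + (m + m). P i) \<longleftrightarrow> (\<forall>i<m. P i \<and> P (m + i) \<and> P (m + (m + i)))" for P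
  proof (intro iffI allI impI)
    fix i assume P: "\<forall>i<m. P i \<and> P (m + i) \<and> P (m + (m + i))" and "i < m + (m + m)"
    then consider "i < m" | "i - m < m" "i = m + (i - m)" | "i - m - m < m" "i = m + (m + (i - m - m))"
      by linarith
    then show "P i" using P by cases metis+
  qed auto
  have three: "{1..3} = {1, 2, 3::nat}" by auto
  show ?thesis
    unfolding vm split three by (simp only: R_mom S_mom ball_simps simp_thms cong: imp_cong) blast
qed

theorem propositionA3:
  fixes \<eta> \<mu> :: nat
    and \<nu> \<rho> :: "nat \<Rightarrow> nat \<times> nat"
    and R S1 S2 S3 S Rt St :: "real mat"
    and U A Ap :: ensemble
  assumes eta: "\<eta> \<ge> 4" "even \<eta>"
    and nu: "bij_betw \<nu> {1..\<eta>\<^sup>2} (Qgrid \<eta>)"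
    and rho: "bij_betw \<rho> {1..card (multi_idx \<mu>)} (multi_idx \<mu>)"
    and R: "R = mat (card (multi_idx \<mu>)) (\<eta>\<^sup>2) (\<lambda>(m, n).
              real (snd (\<nu> (n + 1))) ^ fst (\<rho> (m + 1)) * real (fst (\<nu> (n + 1))) ^ snd (\<rho> (m + 1)))"
    and S1: "S1 = mat (card (multi_idx \<mu>)) (\<eta>\<^sup>2) (\<lambda>(m, n).
              (-1) ^ snd (\<nu> (n + 1)) * R $$ (m, n))"
    and S2: "S2 = mat (card (multi_idx \<mu>)) (\<eta>\<^sup>2) (\<lambda>(m, n).
              (-1) ^ fst (\<nu> (n + 1)) * R $$ (m, n))"
    and S3: "S3 = mat (card (multi_idx \<mu>)) (\<eta>\<^sup>2) (\<lambda>(m, n).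
              (-1) ^ (fst (\<nu> (n + 1)) + snd (\<nu> (n + 1))) * R $$ (m, n))"
    and S: "S = S1 @\<^sub>r S2 @\<^sub>r S3"
    and inv_R: "invertible_mat (R * transpose_mat R)"
    and inv_S: "invertible_mat (S * transpose_mat S)"
    and Rt: "Rt = 1\<^sub>m (\<eta>\<^sup>2) - transpose_mat R * the (mat_inverse (R * transpose_mat R)) * R"
    and St: "St = 1\<^sub>m (\<eta>\<^sup>2) - transpose_mat S * the (mat_inverse (S * transpose_mat S)) * S"
    and U: "U \<in> H_module \<eta>"
    and A: "A = Fourier_inv \<eta> U"
    and Ap: "Ap \<in> Qgrid \<eta> \<rightarrow>\<^sub>E carrier_mat 8 8"
    and Ap00: "vec (\<eta>\<^sup>2) (\<lambda>n. Ap (\<nu> (n + 1)) $$ (0, 0)) =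
        map_vec spinor_part (real_mat_act St
          (vec (\<eta>\<^sup>2) (\<lambda>n. A (\<nu> (n + 1)) $$ (0, 0) + A (\<nu> (n + 1)) $$ (0, 1))))"
    and Ap01: "vec (\<eta>\<^sup>2) (\<lambda>n. Ap (\<nu> (n + 1)) $$ (0, 1)) =
        map_vec vector_part (real_mat_act St
          (vec (\<eta>\<^sup>2) (\<lambda>n. A (\<nu> (n + 1)) $$ (0, 0) + A (\<nu> (n + 1)) $$ (0, 1))))"
    and Ap0_even: "\<And>j. j \<in> {1..3} \<Longrightarrow> vec (\<eta>\<^sup>2) (\<lambda>n. Ap (\<nu> (n + 1)) $$ (0, 2 * j)) =
        map_vec spinor_part (real_mat_act Rt
          (vec (\<eta>\<^sup>2) (\<lambda>n. A (\<nu> (n + 1)) $$ (0, 2 * j) + A (\<nu> (n + 1)) $$ (0, 2 * j + 1))))"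
    and Ap0_odd: "\<And>j. j \<in> {1..3} \<Longrightarrow> vec (\<eta>\<^sup>2) (\<lambda>n. Ap (\<nu> (n + 1)) $$ (0, 2 * j + 1)) =
        map_vec vector_part (real_mat_act Rt
          (vec (\<eta>\<^sup>2) (\<lambda>n. A (\<nu> (n + 1)) $$ (0, 2 * j) + A (\<nu> (n + 1)) $$ (0, 2 * j + 1))))"
    and Ap1: "\<And>n j. n \<in> {1..\<eta>\<^sup>2} \<Longrightarrow> j \<in> {0..3} \<Longrightarrow>
        Ap (\<nu> n) $$ (1, 2 * j) = Ap (\<nu> n) $$ (0, 2 * j + 1) \<and>
        Ap (\<nu> n) $$ (1, 2 * j + 1) = Ap (\<nu> n) $$ (0, 2 * j)"
    and Ap23: "\<And>n r c. n \<in> {1..\<eta>\<^sup>2} \<Longrightarrow> r \<in> {0..1} \<Longrightarrow> c \<in> {0..7} \<Longrightarrow>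
        Ap (\<nu> n) $$ (2 + r, c) = (-1) ^ snd (\<nu> n) * Ap (\<nu> n) $$ (r, c)"
    and Ap4567: "\<And>n r c. n \<in> {1..\<eta>\<^sup>2} \<Longrightarrow> r \<in> {0..3} \<Longrightarrow> c \<in> {0..7} \<Longrightarrow>
        Ap (\<nu> n) $$ (4 + r, c) = (-1) ^ fst (\<nu> n) * Ap (\<nu> n) $$ (r, c)"
  shows "proj_set \<eta> (C2 \<eta> \<mu>) U = {Fourier \<eta> Ap}"
proof -
  define a p where "a = first_row A" and "p = first_row Ap"
  let ?m = "card (multi_idx \<mu>)"
  have eta0: "\<eta> > 0" using eta(1) by simp
  note etas = eta0 eta(2)
  have A_spec: "A = spectrum \<eta> a"
    unfolding a_def A by (rule Fourier_inv_H_module[OF etas U])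
  have U_spec: "U = Fourier \<eta> (spectrum \<eta> a)"
    using Fourier_Fourier_inv[OF eta0, of U] U H_module_iff[of U \<eta>] by (simp flip: A_spec add: A)
  have nu_ex: "\<exists>n<\<eta>\<^sup>2. k = \<nu> (n + 1)" if k: "k \<in> Qgrid \<eta>" for k
  proof -
    obtain n where "n \<in> {1..\<eta>\<^sup>2}" "k = \<nu> n"
      using nu k unfolding bij_betw_def by blast
    then show ?thesis by (intro exI[of _ "n - 1"]) auto
  qed
  \<comment> \<open>Column \<open>q = 0\<close> meets the conditions of \<open>S\<close>, the other three those of \<open>R\<close>.\<close>
  define P where "P q = (if q = 0 then St else Rt)" for q :: nat
  define x where "x q = vec (\<eta>\<^sup>2) (\<lambda>n. a (\<nu> (n + 1)) q)" for q
  define y where "y q = real_mat_act (P q) (x q)" for q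
  have Ap_entries: "Ap (\<nu> (n + 1)) $$ (0, 2 * q) = spinor_part (y q $ n) \<and>
      Ap (\<nu> (n + 1)) $$ (0, 2 * q + 1) = vector_part (y q $ n)" if "n < \<eta>\<^sup>2" "q < 4" for n q
  proof -
    have "vec (\<eta>\<^sup>2) (\<lambda>n. Ap (\<nu> (n + 1)) $$ (0, 2 * q)) = map_vec spinor_part (y q)"
      "vec (\<eta>\<^sup>2) (\<lambda>n. Ap (\<nu> (n + 1)) $$ (0, 2 * q + 1)) = map_vec vector_part (y q)"
      using that(2) Ap00 Ap01 Ap0_even[of q] Ap0_odd[of q]
      by (cases "q = 0"; simp add: y_def x_def P_def a_def first_row_def)+
    then show ?thesis
      using that(1) by (metis (no_types, lifting) dim_vec index_map_vec(1,2) index_vec)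
  qed
  have p_y: "p (\<nu> (n + 1)) q = y q $ n" if "n < \<eta>\<^sup>2" "q < 4" for n q
    using Ap_entries[OF that] graded_part_add_Suc[of 0 "y q $ n"]
    by (simp add: p_def first_row_def graded_part_def)
  have Ap_spec: "Ap = spectrum \<eta> p"
    unfolding p_def
  proof (rule spectrumI[OF Ap])
    fix k and q :: nat assume k: "k \<in> Qgrid \<eta>" and q: "q < 4"
    then obtain n where n: "n < \<eta>\<^sup>2" "k = \<nu> (n + 1)" using nu_ex by blast
    show "graded_part 0 (Ap k $$ (0, 2 * q)) = Ap k $$ (0, 2 * q)"
      "graded_part 1 (Ap k $$ (0, 2 * q + 1)) = Ap k $$ (0, 2 * q + 1)"
      unfolding n(2) Ap_entries[OF n(1) q, THEN conjunct1] Ap_entries[OF n(1) q, THEN conjunct2]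
      by (simp_all add: quat_eq_iff)
    show "Ap k $$ (1, 2 * q) = Ap k $$ (0, 2 * q + 1) \<and> Ap k $$ (1, 2 * q + 1) = Ap k $$ (0, 2 * q)"
      unfolding n(2) using Ap1[of "n + 1" q] n(1) q by auto
  next
    have sign: "(- 1) ^ e * v = (- 1) ^ e *\<^sub>R v" for e :: nat and v :: quat
      by (cases "even e") simp_all
    fix k and r c :: nat assume k: "k \<in> Qgrid \<eta>" and c: "c < 8"
    then obtain n where n: "n < \<eta>\<^sup>2" "k = \<nu> (n + 1)" using nu_ex by blast
    show "Ap k $$ (2 + r, c) = (- 1) ^ snd k *\<^sub>R Ap k $$ (r, c)" if "r < 2"
      unfolding n(2) using Ap23[of "n + 1" r c] n(1) c that by (simp add: sign)
    show "Ap k $$ (4 + r, c) = (- 1) ^ fst k *\<^sub>R Ap k $$ (r, c)" if "r < 4"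
      unfolding n(2) using Ap4567[of "n + 1" r c] n(1) c that by (simp add: sign)
  qed
  have R': "R = mat ?m (\<eta>\<^sup>2) (\<lambda>(i, n). grid_monomial (\<rho> (i + 1)) (\<nu> (n + 1)))"
    by (simp add: R grid_monomial_def)
  note vm = vanishing_moments_null_space[OF nu rho R' S1 S2 S3 S]
  have R_car: "R \<in> carrier_mat ?m (\<eta>\<^sup>2)"
    by (simp add: R)
  have S_car: "S \<in> carrier_mat (?m + (?m + ?m)) (\<eta>\<^sup>2)"
    unfolding S by (intro carrier_append_rows) (simp_all add: S1 S2 S3)
  have x_car: "x q \<in> carrier_vec (\<eta>\<^sup>2)" for q
    by (simp add: x_def)
  note proj_R = real_mat_act_projection[OF R_car inv_R Rt x_car]
  note proj_S = real_mat_act_projection[OF S_car inv_S St x_car]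
  have "vanishing_moments \<eta> \<mu> p"
    unfolding vm
  proof (intro conjI ballI allI impI)
    fix q i :: nat assume "q \<in> {1..3}" "i < ?m"
    then show "(\<Sum>n<\<eta>\<^sup>2. R $$ (i, n) *\<^sub>R p (\<nu> (n + 1)) q) = 0"
      using proj_R(1)[of i q] p_y[of _ q] by (simp add: y_def P_def)
  next
    fix i assume "i < ?m + (?m + ?m)"
    then show "(\<Sum>n<\<eta>\<^sup>2. S $$ (i, n) *\<^sub>R p (\<nu> (n + 1)) 0) = 0"
      using proj_S(1)[of i 0] p_y[of _ 0] by (simp add: y_def P_def)
  qed
  moreover have "(\<Sum>k\<in>Qgrid \<eta>. \<Sum>q<4. inner (a k q - p k q) (z k q)) = 0"
    if z: "vanishing_moments \<eta> \<mu> z" for z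
  proof -
    have "(\<Sum>n<\<eta>\<^sup>2. inner (x q $ n - y q $ n) (z (\<nu> (n + 1)) q)) = 0" if q: "q < 4" for q
    proof (cases "q = 0")
      case True
      show ?thesis
        using proj_S(2)[of "\<lambda>n. z (\<nu> (n + 1)) 0" 0] z[unfolded vm] by (simp add: True y_def P_def)
    next
      case False
      then have "q \<in> {1..3}" using q by auto
      then show ?thesis
        using proj_R(2)[of "\<lambda>n. z (\<nu> (n + 1)) q" q] z[unfolded vm] False by (simp add: y_def P_def)
    qed
    moreover have "(\<Sum>k\<in>Qgrid \<eta>. inner (a k q - p k q) (z k q)) =
        (\<Sum>n<\<eta>\<^sup>2. inner (x q $ n - y q $ n) (z (\<nu> (n + 1)) q))" if q: "q < 4" for q
      using p_y[OF _ q] by (simp add: sum_enumerated[OF nu] x_def)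
    ultimately show ?thesis
      by (subst sum.swap) simp
  qed
  ultimately show ?thesis
    unfolding U_spec Ap_spec by (rule proj_set_C2I[OF etas])
qed

end
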